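(* Let $D$ be a positive integer valued random variable with $0<P(D\text{ is even})<1$, let $D_1,D_2,\ldots$ be i.i.d. random variables with the distribution of $D$, and let $\Lambda$ be the set of limit points (i.e. subsequential limits as $n\to\infty$) of the sequence of probabilities $$P\big((D_1,\ldots,D_n)\text{ is graphical}\big),\qquad n\ge 1.$$ Then the following statements hold: (a) If $\lim_{n\to\infty} nP(D\ge n)=\infty$, then $\Lambda=\{0\}$. (b) If $\lim_{n\to\infty} nP(D\ge n)=c$, where $0<c<\infty$, and $$\sum_n\left[\frac{c}{n}-P(D\ge n)\right]=\infty,$$ then $\Lambda=\{0\}$. (c) If $\lim_{n\to\infty} nP(D\ge n)=c$, where $0<c<\infty$, $$0<\liminf_{n\to\infty} n^2P(D=n)\le\limsup_{n\to\infty} n^2P(D=n)<\infty$$ and $$\sum_n\left|\frac{c}{n}-P(D\ge n)\right|<\infty,$$ then $\Lambda\subset(0,\tfrac12)$. (d) If $ED<\infty$ or if $$\sup_n n(\log n)P(D\ge n)<\infty,$$ then $\Lambda=\{\tfrac12\}$.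
   Context: A sequence of positive integers $(d_1,\ldots,d_n)$ is called graphical if there exists a simple graph (no loops, no multiple edges) on $n$ vertices whose respective degrees are $d_1,\ldots,d_n$. (By the Erdős–Gallai theorem this is equivalent to: $\sum_i d_i$ is even and the decreasing rearrangement $m_1\ge m_2\ge\cdots\ge m_n$ of $d_1,\ldots,d_n$ satisfies $\sum_{i=1}^j m_i\le j(j-1)+\sum_{i=j+1}^n\min(j,m_i)$ for all $1\le j\le n$.) *)

theory Defs
  imports "HOL-Probability.Probability"
begin

text \<open>
  An edge is a two-element set of vertices, so loops and multiple edges are impossible.
\<close>

definition simple_graph :: "'v set \<Rightarrow> 'v set set \<Rightarrow> bool" where
  "simple_graph V E \<longleftrightarrow> finite V \<and> (\<forall>e\<in>E. e \<subseteq> V \<and> card e = 2)"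

definition vertex_degree :: "'v set set \<Rightarrow> 'v \<Rightarrow> nat" where
  "vertex_degree E v = card {e \<in> E. v \<in> e}"

definition graphical :: "nat list \<Rightarrow> bool" where
  "graphical ds \<longleftrightarrow>
     (\<exists>E. simple_graph {..<length ds} E \<and>
          (\<forall>i<length ds. vertex_degree E i = ds ! i))"

definition prob_graphical :: "'b measure \<Rightarrow> (nat \<Rightarrow> 'b \<Rightarrow> nat) \<Rightarrow> nat \<Rightarrow> real" where
  "prob_graphical N X n = \<P>(\<omega> in N. graphical (map (\<lambda>i. X i \<omega>) [1..<Suc n]))"

text \<open>
  Limit points of the sequence itself (subsequential limits), not accumulation points of its
  range: a constant sequence has its value as a limit point.
\<close>

definition limit_points :: "(nat \<Rightarrow> real) \<Rightarrow> real set" where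
  "limit_points p = {l. \<exists>r::nat \<Rightarrow> nat. strict_mono r \<and> (p \<circ> r) \<longlonglongrightarrow> l}"

end

theory Submission
  imports Defs "HOL-Combinatorics.List_Permutation" "HOL-Real_Asymp.Real_Asymp"
begin

text \<open>
  Write \<open>T k = P (D \<ge> k)\<close> and \<open>H m = E (min D m) = T 1 + \<dots> + T m\<close>. By Erdos and Gallai a degree
  sequence with even sum is realizable when, for every \<open>j\<close>, the sum of its \<open>j\<close> largest entries (the
  demand) is covered, up to terms of order \<open>j\<^sup>2\<close>, by the capacity \<open>\<Sum>i. min j (d i)\<close>. For \<open>n\<close>
  independent degrees the capacity concentrates around \<open>n H j\<close>. The demand comes from the entries
  exceeding a level of order \<open>n / j\<close> and is about \<open>n (H n - H (n / j)) + O(n)\<close>. Once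
  \<open>j\<close> exceeds the square root of \<open>n\<close> by enough, \<open>j (j - 1)\<close> alone beats the total degree, so only
  smaller \<open>j\<close> are at issue. If \<open>T k \<sim> c / k\<close>, demand and capacity are both \<open>n c log j\<close> to leading
  order, and terms of order \<open>n\<close> decide. This explains the four regimes.

  (a) Some degree is at least \<open>n\<close> with probability tending to one, and no simple graph on \<open>n\<close>
  vertices has such a degree.

  (b) The deficit \<open>\<Sum>k\<le>j. c / k - T k\<close> lowers the capacity by an amount that grows with \<open>j\<close>, while the
  demand at a fixed \<open>j\<close> stays within \<open>O(n)\<close> of \<open>n c log j\<close>. Chebyshev's inequality makes
  the condition at this \<open>j\<close> fail with probability close to one (\<open>graphical_prob_bound\<close>), and then
  \<open>j\<close> is sent to infinity (\<open>graphical_prob_tendsto_0_critical\<close>).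

  (c) The limit points stay below \<open>1/2\<close> because a degree of at least \<open>n\<close> has asymptotic probability
  \<open>1 - exp (- c) > 0\<close> and is asymptotically independent of the parity of the sum
  (\<open>graphical_prob_le_even\<close>). They stay above \<open>0\<close> because, at a positive cost in probability, all
  degrees lie below \<open>a n\<close>. Under this conditioning the demand drops by \<open>c n log (1 / a)\<close>, whereas the
  fluctuations are of order \<open>n\<close> with a constant that does not depend on \<open>a\<close>; a small \<open>a\<close>
  therefore makes all conditions hold with probability at least \<open>3/4\<close>
  (\<open>undominated_prob_bound\<close>, \<open>graphical_prob_eventually_ge\<close>).

  (d) All conditions hold with probability tending to one, so that only the parity of the sum matters,
  and it is asymptotically fair. With a finite mean, Markov's inequality is enough. Otherwise
  \<open>H j \<rightarrow> \<infinity>\<close>, whereas under the logarithmic hypothesis the demand remains \<open>O(n)\<close>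
  for all \<open>j\<close> at issue.

  The sufficient direction of the Erdos-Gallai theorem is proved constructively, following Tripathi,
  Venugopalan and West.
\<close>

section \<open>Degrees and neighbourhoods\<close>

definition neighbours :: "'v set set \<Rightarrow> 'v \<Rightarrow> 'v set" where
  "neighbours E v = {u. {v, u} \<in> E}"

lemma simple_graph_finite_edges: "simple_graph V E \<Longrightarrow> finite E"
  unfolding simple_graph_def by (meson Pow_iff finite_Pow_iff finite_subset subsetI)

lemma simple_graph_edge:
  assumes "simple_graph V E" "{a, b} \<in> E"
  shows "a \<in> V" "b \<in> V" "a \<noteq> b"
  using assms unfolding simple_graph_def by auto

lemma neighbours_subset: "simple_graph V E \<Longrightarrow> neighbours E v \<subseteq> V - {v}"
  using simple_graph_edge[of V E v] by (auto simp: neighbours_def)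

lemma finite_neighbours: "simple_graph V E \<Longrightarrow> finite (neighbours E v)"
  using neighbours_subset[of V E v] by (auto simp: simple_graph_def intro: finite_subset)

lemma neighbours_sym: "u \<in> neighbours E v \<longleftrightarrow> v \<in> neighbours E u"
  by (simp add: neighbours_def insert_commute)

lemma vertex_degree_eq_card_neighbours:
  assumes "simple_graph V E"
  shows "vertex_degree E v = card (neighbours E v)"
proof -
  have "bij_betw (\<lambda>u. {v, u}) (neighbours E v) {e \<in> E. v \<in> e}"
  proof (rule bij_betwI')
    fix e assume e: "e \<in> {e \<in> E. v \<in> e}"
    then have "card e = 2" using assms by (auto simp: simple_graph_def)
    then obtain a b where "e = {a, b}" by (auto simp: card_2_iff)
    then show "\<exists>u\<in>neighbours E v. e = {v, u}"
      using e by (auto simp: neighbours_def insert_commute)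
  qed (auto simp: neighbours_def doubleton_eq_iff)
  then show ?thesis
    by (simp add: vertex_degree_def bij_betw_same_card)
qed

lemma vertex_degree_insert:
  assumes "finite E" "{a, b} \<notin> E"
  shows "vertex_degree (insert {a, b} E) v = vertex_degree E v + (if v = a \<or> v = b then 1 else 0)"
proof -
  have "{e \<in> insert {a, b} E. v \<in> e} =
      (if v = a \<or> v = b then insert {a, b} {e \<in> E. v \<in> e} else {e \<in> E. v \<in> e})"
    by auto
  then show ?thesis
    using assms by (simp add: vertex_degree_def)
qed

lemma vertex_degree_remove:
  assumes "finite E" "{a, b} \<in> E"
  shows "vertex_degree E v = vertex_degree (E - {{a, b}}) v + (if v = a \<or> v = b then 1 else 0)"
  using vertex_degree_insert[of "E - {{a, b}}" a b v] assms by (simp add: insert_absorb)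

lemma sum_card_neighbours_swap:
  assumes "finite A" "finite B"
  shows "(\<Sum>a\<in>A. card (neighbours E a \<inter> B)) = (\<Sum>b\<in>B. card (neighbours E b \<inter> A))"
proof -
  have *: "card (neighbours E a \<inter> B) = (\<Sum>b\<in>B. of_bool ({a, b} \<in> E))" if "finite B" for a B
    using that by (simp add: neighbours_def Int_def sum.If_cases of_bool_def conj_commute)
  show ?thesis
    unfolding *[OF assms(1)] *[OF assms(2)]
    by (subst sum.swap) (simp add: insert_commute)
qed

lemma even_sum_vertex_degree:
  assumes "simple_graph V E"
  shows "even (\<Sum>v\<in>V. vertex_degree E v)"
proof -
  have fV: "finite V" and E: "\<And>e. e \<in> E \<Longrightarrow> e \<subseteq> V \<and> card e = 2"
    using assms by (auto simp: simple_graph_def)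
  have "(\<Sum>v\<in>V. vertex_degree E v) = (\<Sum>v\<in>V. \<Sum>e\<in>E. of_bool (v \<in> e))"
    using simple_graph_finite_edges[OF assms]
    by (simp add: vertex_degree_def sum.If_cases of_bool_def Int_def)
  also have "\<dots> = (\<Sum>e\<in>E. \<Sum>v\<in>V. of_bool (v \<in> e))"
    by (rule sum.swap)
  also have "\<dots> = (\<Sum>e\<in>E. 2)"
  proof (rule sum.cong[OF refl])
    fix e assume "e \<in> E"
    then have "V \<inter> {v. v \<in> e} = e" "card e = 2" using E by auto
    then show "(\<Sum>v\<in>V. of_bool (v \<in> e)) = (2::nat)"
      using fV by (simp add: sum.If_cases of_bool_def)
  qed
  finally show ?thesis by simp
qed


section \<open>The sufficient direction of the Erdos-Gallai theorem\<close>

text \<open>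
The invariant of the construction of Tripathi, Venugopalan and West, with \<open>r\<close> as critical vertex. The
independence of the later vertices is what makes the final edge count exact.
\<close>

definition subrealization :: "nat \<Rightarrow> (nat \<Rightarrow> nat) \<Rightarrow> nat \<Rightarrow> nat set set \<Rightarrow> bool" where
  "subrealization n d r E \<longleftrightarrow> simple_graph {..<n} E \<and> (\<forall>v<n. vertex_degree E v \<le> d v)
     \<and> (\<forall>v<r. vertex_degree E v = d v) \<and> (\<forall>u v. r < u \<longrightarrow> r < v \<longrightarrow> {u, v} \<notin> E)"

text \<open>
The critical vertex can always gain an edge while every earlier vertex keeps its degree and the later
vertices remain independent. If no exchange of edges achieves this, then the vertices up to \<open>r\<close> form
a clique and every later vertex \<open>k\<close> has exactly \<open>min (Suc r) (d k)\<close> neighbours, all among them. Counting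
edges then shows that the \<open>r\<close>-th Erdos-Gallai inequality is attained by the current degrees, which
leaves no deficiency at \<open>r\<close>. The exchanges are: a direct edge (\<open>case0\<close>), rerouting one edge of an
earlier non-neighbour of \<open>r\<close> (\<open>case1\<close>), of an earlier non-neighbour of an unsaturated later vertex
(\<open>case2\<close>), or one edge of each of two non-adjacent earlier vertices (\<open>case3\<close>).
\<close>

lemma subrealization_step:
  fixes d :: "nat \<Rightarrow> nat"
  assumes sub: "subrealization n d r E" and r: "r < n" and def: "vertex_degree E r < d r"
    and mono: "\<And>i j. i \<le> j \<Longrightarrow> j < n \<Longrightarrow> d j \<le> d i"
    and even: "even (\<Sum>v<n. d v)"
    and eg: "(\<Sum>i\<le>r. d i) \<le> Suc r * r + (\<Sum>k\<in>{r<..<n}. min (Suc r) (d k))"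
  shows "\<exists>E'. subrealization n d r E' \<and> vertex_degree E r < vertex_degree E' r"
proof (rule ccontr)
  assume no: "\<not> ?thesis"
  have sg: "simple_graph {..<n} E" and le: "\<And>v. v < n \<Longrightarrow> vertex_degree E v \<le> d v"
    and eq: "\<And>v. v < r \<Longrightarrow> vertex_degree E v = d v"
    and ind: "\<And>u v. r < u \<Longrightarrow> r < v \<Longrightarrow> {u, v} \<notin> E"
    using sub by (auto simp: subrealization_def)
  have fE: "finite E" by (rule simple_graph_finite_edges[OF sg])
  note edge = simple_graph_edge[OF sg]
  have deg: "vertex_degree E v = card (neighbours E v)" for v
    by (rule vertex_degree_eq_card_neighbours[OF sg])
  have fin: "finite (neighbours E v)" for v by (rule finite_neighbours[OF sg])
  \<comment> \<open>Every exchange below produces a graph refuting the assumption that no improvement exists.\<close>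
  have improve: False
    if new: "\<And>e. e \<in> E' \<Longrightarrow> e \<in> E \<or> (\<exists>a b. e = {a, b} \<and> a \<le> r \<and> a < n \<and> b < n \<and> a \<noteq> b)"
      and "\<And>v. v < n \<Longrightarrow> vertex_degree E' v \<le> d v"
      "\<And>v. v < r \<Longrightarrow> vertex_degree E' v = d v"
      "vertex_degree E r < vertex_degree E' r" for E'
  proof -
    have "simple_graph {..<n} E'"
      using new sg unfolding simple_graph_def by fastforce
    moreover have "{u, v} \<notin> E'" if uv: "r < u" "r < v" for u v
      using new[of "{u, v}"] ind[OF uv] uv by (auto simp: doubleton_eq_iff)
    ultimately have "subrealization n d r E'"
      using that by (simp add: subrealization_def)
    then show False using no that by blast
  qed
  \<comment> \<open>An earlier vertex has more neighbours than r, because d i >= d r and r is deficient.\<close>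
  have priv: "\<exists>u. {i, u} \<in> E \<and> {r, u} \<notin> E \<and> u \<noteq> r \<and> u \<noteq> i \<and> u < n" if i: "i < r" for i
  proof (rule ccontr)
    assume "\<not> ?thesis"
    then have no_priv: "\<And>u. {i, u} \<in> E \<Longrightarrow> u \<noteq> r \<Longrightarrow> u \<noteq> i \<Longrightarrow> u < n \<Longrightarrow> {r, u} \<in> E"
      by blast
    have sub: "neighbours E i - {r} \<subseteq> neighbours E r - {i}"
    proof
      fix u assume "u \<in> neighbours E i - {r}"
      then have "{i, u} \<in> E" "u \<noteq> r" by (auto simp: neighbours_def)
      then show "u \<in> neighbours E r - {i}"
        using no_priv[of u] edge[of i u] by (auto simp: neighbours_def)
    qed
    have "card (neighbours E r) < card (neighbours E i)"
      using eq[OF i] def mono[of i r] i r by (simp add: deg)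
    moreover have "card (neighbours E i - {r}) \<le> card (neighbours E r - {i})"
      by (rule card_mono[OF _ sub]) (use fin in auto)
    moreover have "r \<in> neighbours E i \<longleftrightarrow> i \<in> neighbours E r"
      by (rule neighbours_sym)
    moreover have "0 < card (neighbours E r)" if "i \<in> neighbours E r"
      using that fin[of r] by (auto simp: card_gt_0_iff)
    ultimately show False
      by (auto simp: card_Diff_singleton_if split: if_splits)
  qed
  have case0: "{r, v} \<in> E" if v: "v < n" "v \<noteq> r" "vertex_degree E v < d v" for v
  proof (rule ccontr)
    assume nE: "{r, v} \<notin> E"
    have d': "vertex_degree (insert {r, v} E) x =
        vertex_degree E x + (if x = r \<or> x = v then 1 else 0)" for x
      by (rule vertex_degree_insert[OF fE nE])
    have "\<not> v < r" using eq v by auto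
    show False
    proof (rule improve[of "insert {r, v} E"])
      show "e \<in> E \<or> (\<exists>a b. e = {a, b} \<and> a \<le> r \<and> a < n \<and> b < n \<and> a \<noteq> b)" if "e \<in> insert {r, v} E" for e
        using that v r by blast
      show "vertex_degree (insert {r, v} E) x \<le> d x" if "x < n" for x
        using d'[of x] le[OF that] def v by (auto split: if_splits)
      show "vertex_degree (insert {r, v} E) x = d x" if "x < r" for x
        using d'[of x] eq[OF that] that \<open>\<not> v < r\<close> by (auto split: if_splits)
      show "vertex_degree E r < vertex_degree (insert {r, v} E) r"
        using d'[of r] by auto
    qed
  qed
  have case1: "{r, i} \<in> E" if i: "i < r" for i
  proof (rule ccontr)
    assume nE: "{r, i} \<notin> E"
    obtain u where u: "{i, u} \<in> E" "{r, u} \<notin> E" "u \<noteq> r" "u \<noteq> i" "u < n"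
      using priv[OF i] by blast
    define E1 where "E1 = E - {{i, u}}"
    define E2 where "E2 = insert {r, u} E1"
    define E3 where "E3 = insert {r, i} E2"
    have n2: "{r, u} \<notin> E1" and n3: "{r, i} \<notin> E2"
      using u nE by (auto simp: E1_def E2_def doubleton_eq_iff)
    have f: "finite E1" "finite E2" "finite E3" using fE by (auto simp: E1_def E2_def E3_def)
    have d1: "vertex_degree E x = vertex_degree E1 x + (if x = i \<or> x = u then 1 else 0)" for x
      unfolding E1_def by (rule vertex_degree_remove[OF fE u(1)])
    have d2: "vertex_degree E2 x = vertex_degree E1 x + (if x = r \<or> x = u then 1 else 0)" for x
      unfolding E2_def by (rule vertex_degree_insert[OF f(1) n2])
    have d3: "vertex_degree E3 x = vertex_degree E2 x + (if x = r \<or> x = i then 1 else 0)" for x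
      unfolding E3_def by (rule vertex_degree_insert[OF f(2) n3])
    have D: "vertex_degree E3 x = vertex_degree E x + (if x = r then 2 else 0)" for x
      using d1[of x] d2[of x] d3[of x] u i
      by (cases "x = r"; cases "x = i"; cases "x = u") simp_all
    show False
    proof (cases "vertex_degree E r + 2 \<le> d r")
      case True
      show False
      proof (rule improve[of E3])
        show "e \<in> E \<or> (\<exists>a b. e = {a, b} \<and> a \<le> r \<and> a < n \<and> b < n \<and> a \<noteq> b)" if "e \<in> E3" for e
        proof -
          have "e \<in> E \<or> e = {r, u} \<or> e = {r, i}"
            using that by (auto simp: E3_def E2_def E1_def)
          moreover have "i < n" "r \<noteq> i" using i r by auto
          ultimately show ?thesis using u r by blast
        qed
        show "vertex_degree E3 v \<le> d v" if "v < n" for v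
          using D[of v] le[OF that] True by (auto split: if_splits)
        show "vertex_degree E3 v = d v" if "v < r" for v
          using D[of v] eq[OF that] that by (auto split: if_splits)
        show "vertex_degree E r < vertex_degree E3 r"
          using D[of r] by auto
      qed
    next
      case False
      \<comment> \<open>The exchange above raises the degree of r by two. When only one is missing, parity provides
        a second deficient vertex, and the edge from r to it is given up in return.\<close>
      have "\<exists>k<n. k \<noteq> r \<and> vertex_degree E k < d k"
      proof (rule ccontr)
        assume "\<not> ?thesis"
        then have "\<And>k. k \<in> {..<n} - {r} \<Longrightarrow> vertex_degree E k = d k"
          using le by force
        then have "(\<Sum>v\<in>{..<n} - {r}. vertex_degree E v) = (\<Sum>v\<in>{..<n} - {r}. d v)"
          by (rule sum.cong[OF refl])
        moreover have "(\<Sum>v<n. vertex_degree E v) =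
            vertex_degree E r + (\<Sum>v\<in>{..<n} - {r}. vertex_degree E v)"
          using r by (simp add: sum.remove)
        moreover have "(\<Sum>v<n. d v) = d r + (\<Sum>v\<in>{..<n} - {r}. d v)"
          using r by (simp add: sum.remove)
        ultimately have "(\<Sum>v<n. d v) = Suc (\<Sum>v<n. vertex_degree E v)"
          using False def by simp
        then show False
          using even even_sum_vertex_degree[OF sg] by simp
      qed
      then obtain k where k: "k < n" "k \<noteq> r" "vertex_degree E k < d k" by blast
      have kr: "{r, k} \<in> E" using case0 k by blast
      have kne: "k \<noteq> i" "k \<noteq> u" using kr nE u by auto
      have kge: "\<not> k < r" using k eq by auto
      define E4 where "E4 = E3 - {{r, k}}"
      have kr3: "{r, k} \<in> E3"
        using kr kne k i by (auto simp: E3_def E2_def E1_def doubleton_eq_iff)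
      have d4: "vertex_degree E3 x = vertex_degree E4 x + (if x = r \<or> x = k then 1 else 0)" for x
        unfolding E4_def by (rule vertex_degree_remove[OF f(3) kr3])
      have D4: "vertex_degree E4 x + (if x = k then 1 else 0)
          = vertex_degree E x + (if x = r then 1 else 0)" for x
        using D[of x] d4[of x] k by (cases "x = r"; cases "x = k") simp_all
      show False
      proof (rule improve[of E4])
        show "e \<in> E \<or> (\<exists>a b. e = {a, b} \<and> a \<le> r \<and> a < n \<and> b < n \<and> a \<noteq> b)" if "e \<in> E4" for e
        proof -
          have "e \<in> E \<or> e = {r, u} \<or> e = {r, i}"
            using that by (auto simp: E4_def E3_def E2_def E1_def)
          moreover have "i < n" "r \<noteq> i" using i r by auto
          ultimately show ?thesis using u r by blast
        qed
        show "vertex_degree E4 v \<le> d v" if "v < n" for v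
          using D4[of v] le[OF that] def by (auto split: if_splits)
        show "vertex_degree E4 v = d v" if "v < r" for v
          using D4[of v] eq[OF that] that kge by (auto split: if_splits)
        show "vertex_degree E r < vertex_degree E4 r"
          using D4[of r] k by auto
      qed
    qed
  qed
  have case2: "vertex_degree E k = min (Suc r) (d k)" if k: "r < k" "k < n" for k
  proof (rule ccontr)
    assume ne: "vertex_degree E k \<noteq> min (Suc r) (d k)"
    have sub: "neighbours E k \<subseteq> {..r}"
      using ind[OF k(1)] by (auto simp: neighbours_def not_less[symmetric])
    then have "card (neighbours E k) \<le> Suc r"
      using card_mono[OF _ sub] by simp
    then have kd: "vertex_degree E k < d k" "card (neighbours E k) < Suc r"
      using ne le[OF k(2)] by (auto simp: deg min_def split: if_splits)
    then have kr: "{r, k} \<in> E" using case0 k by auto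
    have "\<not> {..r} \<subseteq> neighbours E k"
      using kd(2) card_mono[OF fin[of k], of "{..r}"] by auto
    then obtain i where i: "i \<le> r" "{k, i} \<notin> E" by (auto simp: neighbours_def)
    have "i \<noteq> r" using i(2) kr by (auto simp: insert_commute)
    then have ir: "i < r" using i(1) by simp
    obtain u where u: "{i, u} \<in> E" "{r, u} \<notin> E" "u \<noteq> r" "u \<noteq> i" "u < n"
      using priv[OF ir] by blast
    have uk: "u \<noteq> k" using u kr by auto
    define E1 where "E1 = E - {{i, u}}"
    define E2 where "E2 = insert {r, u} E1"
    define E3 where "E3 = insert {i, k} E2"
    have n2: "{r, u} \<notin> E1" and n3: "{i, k} \<notin> E2"
      using u i ir k by (auto simp: E1_def E2_def doubleton_eq_iff insert_commute)
    have f: "finite E1" "finite E2" using fE by (auto simp: E1_def E2_def)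
    have d1: "vertex_degree E x = vertex_degree E1 x + (if x = i \<or> x = u then 1 else 0)" for x
      unfolding E1_def by (rule vertex_degree_remove[OF fE u(1)])
    have d2: "vertex_degree E2 x = vertex_degree E1 x + (if x = r \<or> x = u then 1 else 0)" for x
      unfolding E2_def by (rule vertex_degree_insert[OF f(1) n2])
    have d3: "vertex_degree E3 x = vertex_degree E2 x + (if x = i \<or> x = k then 1 else 0)" for x
      unfolding E3_def by (rule vertex_degree_insert[OF f(2) n3])
    have D: "vertex_degree E3 x = vertex_degree E x + (if x = r \<or> x = k then 1 else 0)" for x
      using d1[of x] d2[of x] d3[of x] u ir k uk
      by (cases "x = r"; cases "x = i"; cases "x = u"; cases "x = k") simp_all
    show False
    proof (rule improve[of E3])
      show "e \<in> E \<or> (\<exists>a b. e = {a, b} \<and> a \<le> r \<and> a < n \<and> b < n \<and> a \<noteq> b)" if "e \<in> E3" for e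
      proof -
        have "e \<in> E \<or> e = {r, u} \<or> e = {i, k}"
          using that by (auto simp: E3_def E2_def E1_def)
        moreover have "i < n" "i \<noteq> k" using ir r k by auto
        ultimately show ?thesis using i u r k by blast
      qed
      show "vertex_degree E3 v \<le> d v" if "v < n" for v
        using D[of v] le[OF that] def kd by (auto split: if_splits)
      show "vertex_degree E3 v = d v" if "v < r" for v
        using D[of v] eq[OF that] that k by (auto split: if_splits)
      show "vertex_degree E r < vertex_degree E3 r"
        using D[of r] by auto
    qed
  qed
  have case3: "{i, j} \<in> E" if ij: "i < j" "j < r" for i j
  proof (rule ccontr)
    assume nE: "{i, j} \<notin> E"
    have ir: "i < r" using ij by simp
    obtain u where u: "{i, u} \<in> E" "{r, u} \<notin> E" "u \<noteq> r" "u \<noteq> i" "u < n"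
      using priv[OF ir] by blast
    obtain w where w: "{j, w} \<in> E" "{r, w} \<notin> E" "w \<noteq> r" "w \<noteq> j" "w < n"
      using priv[OF ij(2)] by blast
    have big: "r < u" "r < w"
      using u(2,3) w(2,3) case1[of u] case1[of w] by (simp_all add: neq_iff) blast+
    define E1 where "E1 = E - {{i, u}}"
    define E2 where "E2 = E1 - {{j, w}}"
    define E3 where "E3 = insert {r, u} E2"
    define E4 where "E4 = insert {i, j} E3"
    have m2: "{j, w} \<in> E1" and n3: "{r, u} \<notin> E2" and n4: "{i, j} \<notin> E3"
      using u w ij big nE by (auto simp: E1_def E2_def E3_def doubleton_eq_iff)
    have f: "finite E1" "finite E2" "finite E3" using fE by (auto simp: E1_def E2_def E3_def)
    have d1: "vertex_degree E x = vertex_degree E1 x + (if x = i \<or> x = u then 1 else 0)" for x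
      unfolding E1_def by (rule vertex_degree_remove[OF fE u(1)])
    have d2: "vertex_degree E1 x = vertex_degree E2 x + (if x = j \<or> x = w then 1 else 0)" for x
      unfolding E2_def by (rule vertex_degree_remove[OF f(1) m2])
    have d3: "vertex_degree E3 x = vertex_degree E2 x + (if x = r \<or> x = u then 1 else 0)" for x
      unfolding E3_def by (rule vertex_degree_insert[OF f(2) n3])
    have d4: "vertex_degree E4 x = vertex_degree E3 x + (if x = i \<or> x = j then 1 else 0)" for x
      unfolding E4_def by (rule vertex_degree_insert[OF f(3) n4])
    have D: "vertex_degree E4 x + (if x = w then 1 else 0)
        = vertex_degree E x + (if x = r then 1 else 0)" for x
      using d1[of x] d2[of x] d3[of x] d4[of x] ij big
      by (cases "x = r"; cases "x = i"; cases "x = j"; cases "x = u"; cases "x = w") simp_all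
    show False
    proof (rule improve[of E4])
      show "e \<in> E \<or> (\<exists>a b. e = {a, b} \<and> a \<le> r \<and> a < n \<and> b < n \<and> a \<noteq> b)" if "e \<in> E4" for e
      proof -
        have "e \<in> E \<or> e = {r, u} \<or> e = {i, j}"
          using that by (auto simp: E4_def E3_def E2_def E1_def)
        moreover have "i < n" "j < n" "i \<noteq> j" "i \<le> r" using ij r by simp_all
        ultimately show ?thesis using u r by blast
      qed
      show "vertex_degree E4 v \<le> d v" if "v < n" for v
        using D[of v] le[OF that] def by (auto split: if_splits)
      show "vertex_degree E4 v = d v" if "v < r" for v
        using D[of v] eq[OF that] that big by (auto split: if_splits)
      show "vertex_degree E r < vertex_degree E4 r"
        using D[of r] big by auto
    qed
  qed
  have clique: "{i, j} \<in> E" if "i \<le> r" "j \<le> r" "i \<noteq> j" for i j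
    using that
  proof (induction i j rule: linorder_wlog)
    case (le i j)
    then show ?case
      using case1[of i] case3[of i j] by (cases "j = r") (auto simp: insert_commute)
  next
    case (sym i j)
    then show ?case by (simp add: insert_commute)
  qed
  have "(\<Sum>i\<le>r. vertex_degree E i) =
      (\<Sum>i\<le>r. card (neighbours E i \<inter> {..r}) + card (neighbours E i \<inter> {r<..<n}))"
  proof (rule sum.cong[OF refl])
    fix i
    have "neighbours E i = (neighbours E i \<inter> {..r}) \<union> (neighbours E i \<inter> {r<..<n})"
      using neighbours_subset[OF sg, of i] by auto
    moreover have "card ((neighbours E i \<inter> {..r}) \<union> (neighbours E i \<inter> {r<..<n})) =
        card (neighbours E i \<inter> {..r}) + card (neighbours E i \<inter> {r<..<n})"
      by (rule card_Un_disjoint) auto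
    ultimately show "vertex_degree E i = card (neighbours E i \<inter> {..r}) + card (neighbours E i \<inter> {r<..<n})"
      unfolding deg by presburger
  qed
  also have "\<dots> = (\<Sum>i\<le>r. r) + (\<Sum>k\<in>{r<..<n}. card (neighbours E k \<inter> {..r}))"
  proof -
    have "card (neighbours E i \<inter> {..r}) = r" if "i \<le> r" for i
    proof -
      have "neighbours E i \<inter> {..r} = {..r} - {i}"
        using clique[OF that] neighbours_subset[OF sg, of i] by (auto simp: neighbours_def)
      then show ?thesis using that by simp
    qed
    then show ?thesis
      by (simp add: sum.distrib sum_card_neighbours_swap[of "{..r}"])
  qed
  also have "(\<Sum>k\<in>{r<..<n}. card (neighbours E k \<inter> {..r})) = (\<Sum>k\<in>{r<..<n}. min (Suc r) (d k))"
  proof (rule sum.cong[OF refl])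
    fix k assume k: "k \<in> {r<..<n}"
    have "neighbours E k \<inter> {..r} = neighbours E k"
      using ind[of k] k by (auto simp: neighbours_def not_less[symmetric])
    then show "card (neighbours E k \<inter> {..r}) = min (Suc r) (d k)"
      using case2[of k] k by (simp add: deg)
  qed
  finally have "(\<Sum>i\<le>r. d i) \<le> (\<Sum>i\<le>r. vertex_degree E i)"
    using eg by simp
  moreover have "(\<Sum>i\<le>r. vertex_degree E i) < (\<Sum>i\<le>r. d i)"
  proof (rule sum_strict_mono_ex1)
    show "\<forall>i\<in>{..r}. vertex_degree E i \<le> d i" using le r by simp
    show "\<exists>i\<in>{..r}. vertex_degree E i < d i" using def by (intro bexI[of _ r]) simp_all
  qed simp
  ultimately show False by simp
qed

theorem Erdos_Gallai_sufficient:
  fixes d :: "nat \<Rightarrow> nat"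
  assumes mono: "\<And>i j. i \<le> j \<Longrightarrow> j < n \<Longrightarrow> d j \<le> d i"
    and even: "even (\<Sum>v<n. d v)"
    and eg: "\<And>r. r < n \<Longrightarrow> (\<Sum>i\<le>r. d i) \<le> Suc r * r + (\<Sum>k\<in>{r<..<n}. min (Suc r) (d k))"
  shows "\<exists>E. simple_graph {..<n} E \<and> (\<forall>v<n. vertex_degree E v = d v)"
proof -
  have "\<exists>E. subrealization n d r E" if "r \<le> n" for r
    using that
  proof (induction r)
    case 0
    show ?case
      by (rule exI[of _ "{}"]) (simp add: subrealization_def simple_graph_def vertex_degree_def)
  next
    case (Suc r)
    then have r: "r < n" and "\<exists>E. subrealization n d r E" by auto
    then obtain E0 where E0: "subrealization n d r E0" by blast
    have "\<exists>E'. subrealization n d r E' \<and> vertex_degree E' r = d r"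
      using E0
    proof (induction "d r - vertex_degree E0 r" arbitrary: E0 rule: less_induct)
      case less
      show ?case
      proof (cases "vertex_degree E0 r < d r")
        case True
        then obtain E' where E': "subrealization n d r E'" "vertex_degree E0 r < vertex_degree E' r"
          using subrealization_step[OF less.prems r True mono even eg[OF r]] by blast
        then show ?thesis using less.hyps[of E'] True by auto
      next
        case False
        then have "vertex_degree E0 r = d r"
          using less.prems r unfolding subrealization_def by (meson le_antisym not_le)
        then show ?thesis using less.prems by blast
      qed
    qed
    then obtain E' where "subrealization n d r E'" "vertex_degree E' r = d r" by blast
    then have "subrealization n d (Suc r) E'"
      by (auto simp: subrealization_def less_Suc_eq)
    then show ?case by blast
  qed
  from this[of n] show ?thesis
    by (auto simp: subrealization_def)
qed

section \<open>Criteria for unsorted degree lists\<close>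

lemma graphical_permute:
  assumes "graphical xs" "mset xs = mset ys"
  shows "graphical ys"
proof -
  obtain p where p: "p permutes {..<length ys}" "permute_list p ys = xs"
    using mset_eq_permutation[OF assms(2)] by metis
  have len: "length xs = length ys" using assms(2) by (rule mset_eq_length)
  obtain E where E: "simple_graph {..<length ys} E"
      "\<And>i. i < length ys \<Longrightarrow> vertex_degree E i = xs ! i"
    using assms(1) by (auto simp: graphical_def len)
  have inj: "inj p" using p(1) by (rule permutes_inj)
  have "simple_graph {..<length ys} ((`) p ` E)"
    using E(1) permutes_image[OF p(1)] inj
    by (auto simp: simple_graph_def card_image inj_on_subset)
  moreover have "vertex_degree ((`) p ` E) i = ys ! i" if i: "i < length ys" for i
  proof -
    obtain k where k: "k < length ys" "i = p k"
      using i permutes_image[OF p(1)] by (metis imageE lessThan_iff)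
    have "{e \<in> (`) p ` E. p k \<in> e} = (`) p ` {e \<in> E. k \<in> e}"
      using inj by (auto simp: inj_eq)
    moreover have "card ((`) p ` {e \<in> E. k \<in> e}) = card {e \<in> E. k \<in> e}"
      by (rule card_image) (use inj in \<open>auto simp: inj_on_def inj_image_eq_iff\<close>)
    ultimately have "vertex_degree ((`) p ` E) i = vertex_degree E k"
      by (simp add: vertex_degree_def k(2))
    also have "\<dots> = ys ! i"
      using E(2)[OF k(1)] permute_list_nth[OF p(1) k(1)] k by (simp add: p(2))
    finally show ?thesis .
  qed
  ultimately show ?thesis unfolding graphical_def by blast
qed

lemma graphical_even: "graphical ds \<Longrightarrow> even (sum_list ds)"
  using even_sum_vertex_degree
  by (fastforce simp: graphical_def sum_list_sum_nth atLeast0LessThan)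

lemma graphical_less_length:
  assumes "graphical ds" "x \<in> set ds"
  shows "x < length ds"
proof -
  obtain E i where E: "simple_graph {..<length ds} E" "i < length ds" "vertex_degree E i = x"
    using assms by (auto simp: graphical_def in_set_conv_nth)
  have "card (neighbours E i) \<le> card ({..<length ds} - {i})"
    by (rule card_mono[OF _ neighbours_subset[OF E(1)]]) simp
  then show ?thesis
    using E vertex_degree_eq_card_neighbours[OF E(1), of i] by simp
qed

text \<open>
The degrees in the set \<open>J\<close> of vertices of degree at least \<open>t\<close> are counted at the other endpoints \<open>u\<close> of
their edges, each of which has at most \<open>min j (d u)\<close> neighbours in \<open>J\<close>. Compared with the Erdos-Gallai
inequality this loses a term of order \<open>j\<^sup>2\<close>, which does not matter for bounded \<open>j\<close>.
\<close>

lemma graphical_large_entries: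
  assumes "graphical ds" "length (filter (\<lambda>x. t \<le> x) ds) \<le> j"
  shows "sum_list (filter (\<lambda>x. t \<le> x) ds) \<le> sum_list (map (min j) ds)"
proof -
  define n where "n = length ds"
  obtain E where E: "simple_graph {..<n} E" "\<And>i. i < n \<Longrightarrow> vertex_degree E i = ds ! i"
    using assms by (auto simp: graphical_def n_def)
  define J where "J = {i. i < n \<and> t \<le> ds ! i}"
  have J: "finite J" "card J \<le> j"
    using assms(2) by (auto simp: J_def length_filter_conv_card n_def)
  have deg: "ds ! i = card (neighbours E i)" if "i < n" for i
    using E(2)[OF that] vertex_degree_eq_card_neighbours[OF E(1), of i] by simp
  have "sum_list (filter (\<lambda>x. t \<le> x) ds) = sum_list (map (\<lambda>x. if t \<le> x then x else 0) ds)"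
    by (induction ds) auto
  also have "\<dots> = (\<Sum>i\<in>J. ds ! i)"
    by (simp add: sum_list_sum_nth atLeast0LessThan sum.If_cases J_def n_def Int_def)
  also have "\<dots> = (\<Sum>i\<in>J. card (neighbours E i \<inter> {..<n}))"
  proof (rule sum.cong[OF refl])
    fix i assume "i \<in> J"
    moreover have "neighbours E i \<inter> {..<n} = neighbours E i"
      using neighbours_subset[OF E(1), of i] by auto
    ultimately show "ds ! i = card (neighbours E i \<inter> {..<n})"
      by (simp add: deg J_def)
  qed
  also have "\<dots> = (\<Sum>u<n. card (neighbours E u \<inter> J))"
    by (rule sum_card_neighbours_swap[OF J(1)]) simp
  also have "\<dots> \<le> (\<Sum>u<n. min j (ds ! u))"
  proof (rule sum_mono)
    fix u assume u: "u \<in> {..<n}"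
    have "card (neighbours E u \<inter> J) \<le> card J" "card (neighbours E u \<inter> J) \<le> card (neighbours E u)"
      using J finite_neighbours[OF E(1)] by (auto intro: card_mono)
    then show "card (neighbours E u \<inter> J) \<le> min j (ds ! u)"
      using J(2) deg[of u] u by simp
  qed
  also have "\<dots> = sum_list (map (min j) ds)"
    by (simp add: sum_list_sum_nth atLeast0LessThan n_def)
  finally show ?thesis .
qed

text \<open>
For any threshold \<open>t\<close>, the \<open>j\<close> largest entries sum to at most \<open>j * t + \<Sum>x. (x - t)\<close>, where \<open>x - t\<close> is
truncated subtraction. The first disjunct therefore yields the \<open>j\<close>-th Erdos-Gallai inequality through
sums over all entries, which concentrate for random samples. The extra \<open>j\<close> is the difference of \<open>j * j\<close>,
which bounds the capacity of the \<open>j\<close> largest entries themselves, and the term \<open>j * (j - 1)\<close>.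
The second disjunct is meant for large \<open>j\<close>.
\<close>

definition dominated :: "nat list \<Rightarrow> nat \<Rightarrow> bool" where
  "dominated ds j \<longleftrightarrow> (\<exists>t. j * t + sum_list (map (\<lambda>x. x - t) ds) + j \<le> sum_list (map (min j) ds))
     \<or> sum_list ds \<le> j * (j - 1)"

lemma graphical_if_dominated:
  assumes "even (sum_list ds)" "\<And>j. 1 \<le> j \<Longrightarrow> j \<le> length ds \<Longrightarrow> dominated ds j"
  shows "graphical ds"
proof (rule graphical_permute)
  define m where "m = rev (sort ds)"
  define n where "n = length ds"
  show ms: "mset (rev (sort ds)) = mset ds" by simp
  have ms: "mset m = mset ds" by (simp add: m_def)
  have len: "length m = n" by (simp add: m_def n_def)
  have tr: "sum_list (map f ds) = (\<Sum>i<n. f (m ! i))" for f :: "nat \<Rightarrow> nat"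
  proof -
    have "sum_list (map f ds) = sum_list (map f m)"
      using ms by (metis mset_map sum_mset_sum_list)
    then show ?thesis by (simp add: sum_list_sum_nth atLeast0LessThan len)
  qed
  have "\<exists>E. simple_graph {..<n} E \<and> (\<forall>v<n. vertex_degree E v = m ! v)"
  proof (rule Erdos_Gallai_sufficient)
    show "m ! j \<le> m ! i" if "i \<le> j" "j < n" for i j
      using that len by (simp add: m_def sorted_rev_nth_mono)
    show "even (\<Sum>v<n. m ! v)"
      using assms(1) tr[of "\<lambda>x. x"] by simp
    fix r assume r: "r < n"
    have dom: "dominated ds (Suc r)" using assms(2)[of "Suc r"] r by (simp add: n_def)
    have split: "{..<n} = {..r} \<union> {r<..<n}" "{..r} \<inter> {r<..<n} = {}" using r by auto
    have spl: "(\<Sum>i<n. f i) = (\<Sum>i\<le>r. f i) + (\<Sum>i\<in>{r<..<n}. f i)" for f :: "nat \<Rightarrow> nat"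
      unfolding split(1) by (rule sum.union_disjoint) (use split(2) in auto)
    have small: "(\<Sum>i\<le>r. min (Suc r) (m ! i)) \<le> Suc r * Suc r"
      using sum_bounded_above[of "{..r}" "\<lambda>i. min (Suc r) (m ! i)" "Suc r"] by simp
    from dom consider t where
        "Suc r * t + sum_list (map (\<lambda>x. x - t) ds) + Suc r \<le> sum_list (map (min (Suc r)) ds)"
      | "sum_list ds \<le> Suc r * r"
      unfolding dominated_def by auto
    then show "(\<Sum>i\<le>r. m ! i) \<le> Suc r * r + (\<Sum>k\<in>{r<..<n}. min (Suc r) (m ! k))"
    proof cases
      case 1
      have "(\<Sum>i\<le>r. m ! i) \<le> (\<Sum>i\<le>r. t + (m ! i - t))" by (rule sum_mono) simp
      also have "\<dots> = Suc r * t + (\<Sum>i\<le>r. m ! i - t)" by (simp only: sum.distrib) simp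
      also have "\<dots> \<le> Suc r * t + (\<Sum>i<n. m ! i - t)" by (simp add: spl)
      finally show ?thesis
        using 1 small by (simp add: tr spl)
    next
      case 2
      have "(\<Sum>i\<le>r. m ! i) \<le> (\<Sum>i<n. m ! i)" by (simp add: spl)
      then show ?thesis using 2 tr[of "\<lambda>x. x"] by simp
    qed
  qed
  then show "graphical (rev (sort ds))"
    by (simp add: graphical_def m_def n_def)
qed

section \<open>Lists of independent samples\<close>

lemma integrable_bounded_pmf:
  fixes f :: "'a \<Rightarrow> real"
  assumes "\<And>x. x \<in> set_pmf p \<Longrightarrow> \<bar>f x\<bar> \<le> B"
  shows "integrable (measure_pmf p) f"
  by (rule measure_pmf.integrable_const_bound[where B = B]) (auto intro!: AE_pmfI assms)

text \<open>
Adding the bounds to \<open>f\<close> and \<open>g\<close> makes both factors nonnegative, and for these Tonelli's theorem applies.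
\<close>

lemma expectation_pair_pmf_mult:
  fixes f :: "'a \<Rightarrow> real" and g :: "'b \<Rightarrow> real"
  assumes f: "\<And>x. x \<in> set_pmf p \<Longrightarrow> \<bar>f x\<bar> \<le> B" and g: "\<And>y. y \<in> set_pmf q \<Longrightarrow> \<bar>g y\<bar> \<le> C"
  shows "measure_pmf.expectation (pair_pmf p q) (\<lambda>z. f (fst z) * g (snd z)) =
    measure_pmf.expectation p f * measure_pmf.expectation q g"
proof -
  have nonneg: "measure_pmf.expectation (pair_pmf p q) (\<lambda>z. u (fst z) * v (snd z)) =
    measure_pmf.expectation p u * measure_pmf.expectation q v"
    if u: "\<And>x. x \<in> set_pmf p \<Longrightarrow> 0 \<le> u x \<and> u x \<le> K"
      and v: "\<And>y. y \<in> set_pmf q \<Longrightarrow> 0 \<le> v y \<and> v y \<le> L"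
    for u :: "'a \<Rightarrow> real" and v :: "'b \<Rightarrow> real" and K L
  proof -
    have iu: "integrable p u" and iv: "integrable q v"
      using u v by (auto intro: integrable_bounded_pmf[where B = K] integrable_bounded_pmf[where B = L])
    have "(\<integral>\<^sup>+z. ennreal (u (fst z) * v (snd z)) \<partial>pair_pmf p q) =
        (\<integral>\<^sup>+a. \<integral>\<^sup>+b. ennreal (u a) * ennreal (v b) \<partial>q \<partial>p)"
      unfolding nn_integral_pair_pmf'
      by (intro nn_integral_cong_AE AE_pmfI) (use u v in \<open>auto simp: ennreal_mult\<close>)
    also have "\<dots> = (\<integral>\<^sup>+a. ennreal (u a) \<partial>p) * (\<integral>\<^sup>+b. ennreal (v b) \<partial>q)"
      by (simp add: nn_integral_cmult nn_integral_multc)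
    also have "(\<integral>\<^sup>+a. ennreal (u a) \<partial>p) = ennreal (measure_pmf.expectation p u)"
      by (rule nn_integral_eq_integral[OF iu]) (use u in \<open>auto intro: AE_pmfI\<close>)
    also have "(\<integral>\<^sup>+a. ennreal (v a) \<partial>q) = ennreal (measure_pmf.expectation q v)"
      by (rule nn_integral_eq_integral[OF iv]) (use v in \<open>auto intro: AE_pmfI\<close>)
    also have "ennreal (measure_pmf.expectation p u) * ennreal (measure_pmf.expectation q v) =
        ennreal (measure_pmf.expectation p u * measure_pmf.expectation q v)"
      by (rule ennreal_mult[symmetric])
        (use u v in \<open>auto intro!: integral_nonneg_AE AE_pmfI\<close>)
    finally have nn: "(\<integral>\<^sup>+z. ennreal (u (fst z) * v (snd z)) \<partial>pair_pmf p q) =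
        ennreal (measure_pmf.expectation p u * measure_pmf.expectation q v)" .
    have "0 \<le> measure_pmf.expectation p u * measure_pmf.expectation q v"
      by (intro mult_nonneg_nonneg integral_nonneg_AE AE_pmfI) (use u v in auto)
    moreover have "AE z in pair_pmf p q. 0 \<le> u (fst z) * v (snd z)"
      by (intro AE_pmfI mult_nonneg_nonneg) (use u v in auto)
    ultimately show ?thesis
      by (subst integral_eq_nn_integral) (simp_all add: nn)
  qed
  let ?I = "\<lambda>h. measure_pmf.expectation (pair_pmf p q) h"
  have [simp]: "integrable p f" "integrable q g"
    using f g by (auto intro: integrable_bounded_pmf)
  have [simp]: "integrable (pair_pmf p q) (\<lambda>z. f (fst z) * g (snd z))"
    by (rule integrable_bounded_pmf[where B = "B * C"])
      (use f g in \<open>auto simp: abs_mult intro!: mult_mono order_trans[OF abs_ge_zero]\<close>)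
  have [simp]: "integrable (pair_pmf p q) (\<lambda>z. f (fst z))"
    by (rule integrable_bounded_pmf[where B = B]) (use f in auto)
  have [simp]: "integrable (pair_pmf p q) (\<lambda>z. g (snd z))"
    by (rule integrable_bounded_pmf[where B = C]) (use g in auto)
  have "?I (\<lambda>z. (f (fst z) + B) * (g (snd z) + C)) =
      measure_pmf.expectation p (\<lambda>x. f x + B) * measure_pmf.expectation q (\<lambda>y. g y + C)"
    by (rule nonneg[where K = "2 * B" and L = "2 * C"])
      (use f g in \<open>force simp: abs_le_iff\<close>)+
  moreover have "?I (\<lambda>z. (f (fst z) + B) * (g (snd z) + C)) =
      ?I (\<lambda>z. f (fst z) * g (snd z)) + C * measure_pmf.expectation p f
        + B * measure_pmf.expectation q g + B * C"
    by (simp add: ring_distribs mult.commute)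
  ultimately show ?thesis
    by (simp add: ring_distribs mult.commute)
qed

lemma replicate_pmf_Suc_pair:
  "replicate_pmf (Suc n) p = map_pmf (\<lambda>z. fst z # snd z) (pair_pmf p (replicate_pmf n p))"
  by (simp add: pair_pmf_def map_bind_pmf bind_return_pmf map_pmf_def bind_assoc_pmf)

lemma
  fixes f :: "'a \<Rightarrow> real"
  assumes "integrable (measure_pmf p) f"
  shows integrable_sum_replicate_pmf:
      "integrable (measure_pmf (replicate_pmf n p)) (\<lambda>xs. sum_list (map f xs))"
    and expectation_sum_replicate_pmf:
      "measure_pmf.expectation (replicate_pmf n p) (\<lambda>xs. sum_list (map f xs)) =
        n * measure_pmf.expectation p f"
proof (induction n)
  case 0
  { case 1 then show ?case by (simp add: integrable_measure_pmf_finite) }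
  { case 2 then show ?case by simp }
next
  case (Suc n)
  have i1: "integrable (pair_pmf p (replicate_pmf n p)) (\<lambda>z. f (fst z))"
    using assms integrable_map_pmf_eq[of fst "pair_pmf p (replicate_pmf n p)" f]
    by (simp add: map_fst_pair_pmf)
  have i2: "integrable (pair_pmf p (replicate_pmf n p)) (\<lambda>z. sum_list (map f (snd z)))"
    using Suc integrable_map_pmf_eq[of snd "pair_pmf p (replicate_pmf n p)" "\<lambda>xs. sum_list (map f xs)"]
    by (simp add: map_snd_pair_pmf)
  { case 1 then show ?case
      unfolding replicate_pmf_Suc_pair using i1 i2 by simp }
  { case 2 then show ?case
      unfolding replicate_pmf_Suc_pair using i1 i2 Suc(2)
      expectation_pair_pmf_snd[of p "replicate_pmf n p" "\<lambda>xs. sum_list (map f xs)"]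
      by (simp add: algebra_simps) }
qed

lemma length_replicate_pmf: "xs \<in> set_pmf (replicate_pmf n p) \<Longrightarrow> length xs = n"
  by (simp add: set_replicate_pmf)

lemma replicate_pmf_entries: "xs \<in> set_pmf (replicate_pmf n p) \<Longrightarrow> x \<in> set xs \<Longrightarrow> x \<in> set_pmf p"
  by (auto simp: set_replicate_pmf)

lemma abs_sum_list_replicate_pmf_le:
  fixes f :: "'a \<Rightarrow> real"
  assumes f: "\<And>x. x \<in> set_pmf p \<Longrightarrow> \<bar>f x\<bar> \<le> B" and xs: "xs \<in> set_pmf (replicate_pmf n p)"
  shows "\<bar>sum_list (map f xs)\<bar> \<le> n * B"
proof -
  have "\<bar>sum_list (map f xs)\<bar> \<le> length xs * B" if "\<forall>x\<in>set xs. x \<in> set_pmf p" for xs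
    using that
  proof (induction xs)
    case (Cons x xs)
    then show ?case using f[of x] abs_triangle_ineq[of "f x" "sum_list (map f xs)"]
      by (simp add: algebra_simps)
  qed simp
  then show ?thesis using xs replicate_pmf_entries length_replicate_pmf by metis
qed

lemma second_moment_sum_replicate_pmf:
  fixes f :: "'a \<Rightarrow> real"
  assumes f: "\<And>x. x \<in> set_pmf p \<Longrightarrow> \<bar>f x\<bar> \<le> B" and mean: "measure_pmf.expectation p f = 0"
  shows "measure_pmf.expectation (replicate_pmf n p) (\<lambda>xs. (sum_list (map f xs))\<^sup>2) =
    n * measure_pmf.expectation p (\<lambda>x. (f x)\<^sup>2)"
proof (induction n)
  case (Suc n)
  let ?q = "pair_pmf p (replicate_pmf n p)" and ?S = "\<lambda>xs. sum_list (map f xs)"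
  have S: "\<bar>?S xs\<bar> \<le> n * B" if "xs \<in> set_pmf (replicate_pmf n p)" for xs
    using abs_sum_list_replicate_pmf_le[OF f that] by simp
  have i1: "integrable ?q (\<lambda>z. (f (fst z))\<^sup>2)"
    by (rule integrable_bounded_pmf[where B = "B\<^sup>2"])
      (use f in \<open>auto simp: abs_le_square_iff[symmetric] intro: order_trans[OF _ abs_ge_self]\<close>)
  have i2: "integrable ?q (\<lambda>z. (?S (snd z))\<^sup>2)"
    by (rule integrable_bounded_pmf[where B = "(n * B)\<^sup>2"])
      (use S in \<open>auto simp: abs_le_square_iff[symmetric] simp del: of_nat_mult intro: order_trans[OF _ abs_ge_self]\<close>)
  have i3: "integrable ?q (\<lambda>z. f (fst z) * ?S (snd z))"
    by (rule integrable_bounded_pmf[where B = "B * (n * B)"])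
      (use f S in \<open>auto simp: abs_mult intro!: mult_mono order_trans[OF abs_ge_zero]\<close>)
  have cross: "measure_pmf.expectation ?q (\<lambda>z. f (fst z) * ?S (snd z)) = 0"
    using expectation_pair_pmf_mult[of p f B "replicate_pmf n p" ?S "n * B"] f S mean by simp
  have "measure_pmf.expectation (replicate_pmf (Suc n) p) (\<lambda>xs. (?S xs)\<^sup>2) =
     measure_pmf.expectation ?q (\<lambda>z. (f (fst z))\<^sup>2 + (?S (snd z))\<^sup>2 + 2 * (f (fst z) * ?S (snd z)))"
    unfolding replicate_pmf_Suc_pair by (simp add: power2_sum algebra_simps)
  also have "\<dots> = measure_pmf.expectation ?q (\<lambda>z. (f (fst z))\<^sup>2)
      + measure_pmf.expectation ?q (\<lambda>z. (?S (snd z))\<^sup>2)"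
    using i1 i2 i3 cross by simp
  also have "\<dots> = measure_pmf.expectation p (\<lambda>x. (f x)\<^sup>2)
      + measure_pmf.expectation (replicate_pmf n p) (\<lambda>xs. (?S xs)\<^sup>2)"
    using expectation_pair_pmf_fst[of p "replicate_pmf n p" "\<lambda>x. (f x)\<^sup>2"]
      expectation_pair_pmf_snd[of p "replicate_pmf n p" "\<lambda>xs. (?S xs)\<^sup>2"] by simp
  finally show ?case using Suc by (simp add: algebra_simps)
qed simp

lemma Chebyshev_replicate_pmf:
  fixes f :: "'a \<Rightarrow> real"
  assumes f: "\<And>x. x \<in> set_pmf p \<Longrightarrow> \<bar>f x\<bar> \<le> B" and s: "s > 0"
  shows "measure_pmf.prob (replicate_pmf n p)
      {xs. \<bar>sum_list (map f xs) - n * measure_pmf.expectation p f\<bar> \<ge> s}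
    \<le> n * measure_pmf.expectation p (\<lambda>x. (f x)\<^sup>2) / s\<^sup>2"
proof -
  define m where "m = measure_pmf.expectation p f"
  let ?r = "replicate_pmf n p"
  have int: "integrable p f" by (rule integrable_bounded_pmf[OF f])
  have int2: "integrable p (\<lambda>x. (f x)\<^sup>2)"
    by (rule integrable_bounded_pmf[where B = "B\<^sup>2"])
      (use f in \<open>auto simp: abs_le_square_iff[symmetric] intro: order_trans[OF _ abs_ge_self]\<close>)
  have fm: "\<bar>f x - m\<bar> \<le> B + \<bar>m\<bar>" if "x \<in> set_pmf p" for x
    using f[OF that] by linarith
  have mean: "measure_pmf.expectation p (\<lambda>x. f x - m) = 0"
    using int by (simp add: m_def)
  have centred: "sum_list (map (\<lambda>x. f x - m) xs) = sum_list (map f xs) - n * m"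
    if "xs \<in> set_pmf ?r" for xs
    using length_replicate_pmf[OF that] by (simp add: sum_list_subtractf sum_list_triv)
  have "measure_pmf.prob ?r {xs. \<bar>sum_list (map f xs) - n * m\<bar> \<ge> s} =
      measure_pmf.prob ?r {xs. \<bar>sum_list (map (\<lambda>x. f x - m) xs)\<bar> \<ge> s}"
    by (rule measure_pmf.finite_measure_eq_AE) (auto intro!: AE_pmfI simp: centred)
  also have "\<dots> \<le> measure_pmf.expectation ?r (\<lambda>xs. (sum_list (map (\<lambda>x. f x - m) xs))\<^sup>2) / s\<^sup>2"
  proof (rule measure_pmf.second_moment_method[of "\<lambda>xs. sum_list (map (\<lambda>x. f x - m) xs)" ?r s, simplified])
    show "integrable ?r (\<lambda>xs. (sum_list (map (\<lambda>x. f x - m) xs))\<^sup>2)"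
      by (rule integrable_bounded_pmf[where B = "(n * (B + \<bar>m\<bar>))\<^sup>2"])
        (use abs_sum_list_replicate_pmf_le[of p "\<lambda>x. f x - m" "B + \<bar>m\<bar>"] fm in
          \<open>auto simp: abs_le_square_iff[symmetric] intro: order_trans[OF _ abs_ge_self]\<close>)
  qed (use s in auto)
  also have "\<dots> = n * measure_pmf.expectation p (\<lambda>x. (f x - m)\<^sup>2) / s\<^sup>2"
    using second_moment_sum_replicate_pmf[of p "\<lambda>x. f x - m" "B + \<bar>m\<bar>" n] fm mean by simp
  also have "measure_pmf.expectation p (\<lambda>x. (f x - m)\<^sup>2) \<le> measure_pmf.expectation p (\<lambda>x. (f x)\<^sup>2)"
    using measure_pmf.variance_eq[of p f] int int2 by (simp add: m_def)
  finally show ?thesis using s by (simp add: m_def divide_right_mono mult_left_mono)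
qed

lemma Markov_replicate_pmf:
  fixes f :: "'a \<Rightarrow> real"
  assumes int: "integrable (measure_pmf p) f" and nn: "\<And>x. x \<in> set_pmf p \<Longrightarrow> 0 \<le> f x" and s: "s > 0"
  shows "measure_pmf.prob (replicate_pmf n p) {xs. sum_list (map f xs) \<ge> s}
    \<le> n * measure_pmf.expectation p f / s"
proof -
  have "measure_pmf.prob (replicate_pmf n p) {xs \<in> space (replicate_pmf n p). s \<le> sum_list (map f xs)} \<le>
      measure_pmf.expectation (replicate_pmf n p) (\<lambda>xs. sum_list (map f xs)) / s"
    by (rule integral_Markov_inequality_measure)
      (use s in \<open>auto intro!: AE_pmfI sum_list_nonneg integrable_sum_replicate_pmf[OF int]
          nn replicate_pmf_entries[of _ n p]\<close>)
  then show ?thesis by (simp add: expectation_sum_replicate_pmf[OF int])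
qed

lemma expectation_prod_replicate_pmf:
  fixes f :: "'a \<Rightarrow> real"
  assumes f: "\<And>x. \<bar>f x\<bar> \<le> 1"
  shows "measure_pmf.expectation (replicate_pmf n p) (\<lambda>xs. prod_list (map f xs)) =
    (measure_pmf.expectation p f) ^ n"
proof (induction n)
  case (Suc n)
  have "\<bar>prod_list (map f xs)\<bar> \<le> 1" for xs
    by (induction xs) (auto simp: abs_mult intro!: mult_le_one f)
  then show ?case
    unfolding replicate_pmf_Suc_pair
    using expectation_pair_pmf_mult[of p f 1 "replicate_pmf n p" "\<lambda>xs. prod_list (map f xs)" 1] f Suc
    by simp
qed simp

lemma prob_all_replicate_pmf:
  "measure_pmf.prob (replicate_pmf n p) {xs. set xs \<subseteq> S} = measure_pmf.prob p S ^ n"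
proof -
  have ind: "indicator {xs. set xs \<subseteq> S} xs = (prod_list (map (indicator S) xs) :: real)" for xs
    by (induction xs) (simp_all add: indicator_def of_bool_conj)
  have "measure_pmf.prob (replicate_pmf n p) {xs. set xs \<subseteq> S} =
     measure_pmf.expectation (replicate_pmf n p) (\<lambda>xs. indicator {xs. set xs \<subseteq> S} xs)"
    by simp
  also have "\<dots> = measure_pmf.expectation (replicate_pmf n p) (\<lambda>xs. prod_list (map (indicator S) xs))"
    unfolding ind ..
  also have "\<dots> = measure_pmf.prob p S ^ n"
    by (subst expectation_prod_replicate_pmf) (auto simp: indicator_def)
  finally show ?thesis .
qed

text \<open>
The event has indicator \<open>(\<Prod>x. 1\<^sub>S x + \<Prod>x. 1\<^sub>S x (-1)^x) / 2\<close>, and by independence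
the expectation of each product is an \<open>n\<close>-th power.
\<close>

lemma prob_all_even_replicate_pmf:
  "measure_pmf.prob (replicate_pmf n p) {xs. set xs \<subseteq> S \<and> even (sum_list xs)} =
    (measure_pmf.prob p S ^ n + measure_pmf.expectation p (\<lambda>x. indicator S x * (-1) ^ x) ^ n) / 2"
proof -
  let ?r = "replicate_pmf n p"
  let ?f = "\<lambda>x. indicator S x * (-1 :: real) ^ x"
  have prod: "prod_list (map ?f xs) = indicator {xs. set xs \<subseteq> S} xs * (-1) ^ sum_list xs" for xs
    by (induction xs) (simp_all add: indicator_def of_bool_conj power_add)
  have ind: "indicator {xs. set xs \<subseteq> S \<and> even (sum_list xs)} xs =
      (indicator {xs. set xs \<subseteq> S} xs + prod_list (map ?f xs)) / 2" for xs
    unfolding prod by (auto simp: indicator_def)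
  have "measure_pmf.prob ?r {xs. set xs \<subseteq> S \<and> even (sum_list xs)} =
      measure_pmf.expectation ?r (\<lambda>xs. indicator {xs. set xs \<subseteq> S \<and> even (sum_list xs)} xs)"
    by simp
  also have "\<dots> = measure_pmf.expectation ?r (\<lambda>xs. (indicator {xs. set xs \<subseteq> S} xs + prod_list (map ?f xs)) / 2)"
    unfolding ind ..
  also have "\<dots> = (measure_pmf.expectation ?r (indicator {xs. set xs \<subseteq> S})
      + measure_pmf.expectation ?r (\<lambda>xs. prod_list (map ?f xs))) / 2"
  proof -
    have "integrable ?r (\<lambda>xs. prod_list (map ?f xs))"
      unfolding prod by (rule integrable_bounded_pmf[where B = 1]) (auto simp: indicator_def)
    moreover have "integrable ?r (indicator {xs. set xs \<subseteq> S} :: _ \<Rightarrow> real)"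
      by (rule integrable_bounded_pmf[where B = 1]) (auto simp: indicator_def)
    ultimately show ?thesis by simp
  qed
  also have "measure_pmf.expectation ?r (\<lambda>xs. prod_list (map ?f xs)) = measure_pmf.expectation p ?f ^ n"
    by (rule expectation_prod_replicate_pmf) (auto simp: indicator_def)
  also have "measure_pmf.expectation ?r (indicator {xs. set xs \<subseteq> S}) = measure_pmf.prob p S ^ n"
    by (simp add: prob_all_replicate_pmf)
  finally show ?thesis .
qed

lemma pmf_replicate_pmf:
  "pmf (replicate_pmf n p) xs = (if length xs = n then prod_list (map (pmf p) xs) else 0)"
proof (induction n arbitrary: xs)
  case (Suc n)
  show ?case
  proof (cases xs)
    case Nil
    then have "xs \<notin> set_pmf (replicate_pmf (Suc n) p)" using length_replicate_pmf by force
    then show ?thesis using Nil by (simp add: set_pmf_iff del: replicate_pmf.simps)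
  next
    case (Cons y ys)
    have "inj (\<lambda>z :: 'a \<times> 'a list. fst z # snd z)" by (auto simp: inj_def prod_eq_iff)
    then have "pmf (replicate_pmf (Suc n) p) xs = pmf (pair_pmf p (replicate_pmf n p)) (y, ys)"
      unfolding replicate_pmf_Suc_pair Cons
      using pmf_map_inj'[of "\<lambda>z. fst z # snd z" "pair_pmf p (replicate_pmf n p)" "(y, ys)"] by simp
    then show ?thesis using Cons Suc by (simp add: pmf_pair)
  qed
qed (auto simp: indicator_def)

lemma prob_replicate_cond_pmf:
  assumes S: "set_pmf p \<inter> S \<noteq> {}"
  shows "measure_pmf.prob (replicate_pmf n p) {xs. set xs \<subseteq> S \<and> Q xs} =
    measure_pmf.prob p S ^ n * measure_pmf.prob (replicate_pmf n (cond_pmf p S)) {xs. Q xs}"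
proof -
  let ?A = "{xs. set xs \<subseteq> S}"
  have pos: "measure_pmf.prob p S \<noteq> 0" using measure_measure_pmf_not_zero[OF S] .
  have ne: "set_pmf (replicate_pmf n p) \<inter> ?A \<noteq> {}"
    using prob_all_replicate_pmf[of n p S] pos
    by (metis measure_pmf_zero_iff power_not_zero)
  have "replicate_pmf n (cond_pmf p S) = cond_pmf (replicate_pmf n p) ?A"
  proof (rule pmf_eqI)
    fix xs
    have "prod_list (map (pmf (cond_pmf p S)) xs) =
        (if set xs \<subseteq> S then prod_list (map (pmf p) xs) / measure_pmf.prob p S ^ length xs else 0)"
      by (induction xs) (auto simp: pmf_cond[OF S])
    then show "pmf (replicate_pmf n (cond_pmf p S)) xs = pmf (cond_pmf (replicate_pmf n p) ?A) xs"
      by (simp add: pmf_replicate_pmf pmf_cond[OF ne] prob_all_replicate_pmf)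
  qed
  then have "measure_pmf.prob (replicate_pmf n (cond_pmf p S)) {xs. Q xs} =
      measure (uniform_measure (measure_pmf (replicate_pmf n p)) ?A) {xs. Q xs}"
    by (simp add: cond_pmf.rep_eq[OF ne])
  also have "\<dots> = measure_pmf.prob (replicate_pmf n p) (?A \<inter> {xs. Q xs}) / measure_pmf.prob p S ^ n"
    using pos by (subst measure_uniform_measure)
      (auto simp: prob_all_replicate_pmf measure_pmf.emeasure_eq_measure)
  finally show ?thesis using pos by (simp add: Int_def)
qed

lemma pmf_of_countable_distr:
  fixes D :: "'a \<Rightarrow> 'b :: countable"
  assumes "prob_space M" "D \<in> measurable M (count_space UNIV)"
  obtains p where "measure_pmf p = distr M (count_space UNIV) D"
proof -
  let ?d = "distr M (count_space UNIV) D"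
  interpret M: prob_space M by fact
  interpret d: prob_space ?d by (rule M.prob_space_distr[OF assms(2)])
  have "(\<Union>x\<in>{x. measure ?d {x} = 0}. {x}) \<in> null_sets ?d"
    by (rule null_sets_UN') (auto simp: null_sets_def d.emeasure_eq_measure)
  then have "AE x in ?d. measure ?d {x} \<noteq> 0"
    by (rule AE_I') auto
  then have "?d \<in> {M. prob_space M \<and> sets M = UNIV \<and> (AE x in M. measure M {x} \<noteq> 0)}"
    using d.prob_space_axioms by simp
  then show ?thesis using that[of "Abs_pmf ?d"] by (simp add: Abs_pmf_inverse)
qed

text \<open>
From here on only laws of finite lists matter: all events are measurable, and product and conditional laws
have explicit probability mass functions.
\<close>

lemma iid_list_replicate_pmf:
  fixes X :: "nat \<Rightarrow> 'a \<Rightarrow> 'b :: countable"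
  assumes N: "prob_space N"
    and ind: "prob_space.indep_vars N (\<lambda>_. count_space UNIV) X {1..}"
    and law: "\<And>i. 1 \<le> i \<Longrightarrow> distr N (count_space UNIV) (X i) = measure_pmf p"
  shows "\<P>(\<omega> in N. Q (map (\<lambda>i. X i \<omega>) [1..<Suc n])) = measure_pmf.prob (replicate_pmf n p) {xs. Q xs}"
proof -
  interpret N: prob_space N by fact
  let ?V = "\<lambda>\<omega>. map (\<lambda>i. X i \<omega>) [1..<Suc n]"
  have X: "X i \<in> measurable N (count_space UNIV)" if "1 \<le> i" for i
    using ind that by (auto simp: N.indep_vars_def)
  have vimage: "?V -` {xs} \<inter> space N =
      (if length xs = n then (\<Inter>i\<in>{1..n}. X i -` {xs ! (i - 1)} \<inter> space N) \<inter> space N else {})" for xs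
  proof (cases "length xs = n")
    case True
    have "?V \<omega> = xs \<longleftrightarrow> (\<forall>i\<in>{1..n}. X i \<omega> = xs ! (i - 1))" for \<omega>
    proof -
      have "?V \<omega> = xs \<longleftrightarrow> (\<forall>k<n. X (Suc k) \<omega> = xs ! k)"
        using True by (simp add: list_eq_iff_nth_eq del: upt_Suc)
      also have "\<dots> \<longleftrightarrow> (\<forall>i\<in>Suc ` {..<n}. X i \<omega> = xs ! (i - 1))" by auto
      finally show ?thesis by (simp only: image_Suc_lessThan)
    qed
    then have "\<omega> \<in> ?V -` {xs} \<longleftrightarrow> (\<forall>i\<in>{1..n}. X i \<omega> = xs ! (i - 1))" for \<omega>
      by (simp del: upt_Suc)
    then show ?thesis unfolding if_P[OF True] by blast
  next
    case False
    then have "?V \<omega> \<noteq> xs" for \<omega> by (auto simp del: upt_Suc)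
    then show ?thesis using False by (auto simp del: upt_Suc)
  qed
  have sets: "?V -` {xs} \<inter> space N \<in> sets N" for xs
  proof (cases "n = 0")
    case False
    have "(\<Inter>i\<in>{1..n}. X i -` {xs ! (i - 1)} \<inter> space N) \<inter> space N \<in> sets N"
      by (intro sets.Int sets.finite_INT measurable_sets[OF X]) (use False in auto)
    then show ?thesis unfolding vimage by simp
  qed (simp add: vimage)
  have V: "?V \<in> measurable N (count_space UNIV)"
    by (rule measurable_count_space_eq_countable[THEN iffD2]) (use sets in auto)
  have prob: "measure N (?V -` {xs} \<inter> space N) = pmf (replicate_pmf n p) xs" for xs
  proof (cases "length xs = n \<and> n > 0")
    case True
    have "measure N (?V -` {xs} \<inter> space N) = N.prob (\<Inter>i\<in>{1..n}. X i -` {xs ! (i - 1)} \<inter> space N)"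
      unfolding vimage using True by (auto intro!: arg_cong[of _ _ "measure N"])
    also have "\<dots> = (\<Prod>i\<in>{1..n}. N.prob (X i -` {xs ! (i - 1)} \<inter> space N))"
      by (rule N.indep_varsD[OF ind]) (use True in auto)
    also have "\<dots> = (\<Prod>i\<in>{1..n}. pmf p (xs ! (i - 1)))"
    proof (rule prod.cong[OF refl])
      fix i assume "i \<in> {1..n}"
      then have i: "1 \<le> i" by simp
      show "N.prob (X i -` {xs ! (i - 1)} \<inter> space N) = pmf p (xs ! (i - 1))"
        using measure_distr[OF X[OF i], of "{xs ! (i - 1)}"] law[OF i]
        by (simp add: measure_pmf_single)
    qed
    also have "\<dots> = (\<Prod>i<n. pmf p (xs ! i))"
      by (rule prod.reindex_bij_witness[of _ Suc "\<lambda>i. i - 1"]) auto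
    also have "\<dots> = prod_list (map (pmf p) xs)"
      using True by (simp add: prod.list_conv_set_nth atLeast0LessThan)
    finally show ?thesis using True by (simp add: pmf_replicate_pmf)
  next
    case False
    then show ?thesis unfolding vimage by (auto simp: pmf_replicate_pmf N.prob_space)
  qed
  have "distr N (count_space UNIV) ?V = measure_pmf (replicate_pmf n p)"
  proof (rule measure_eqI_countable[of _ UNIV])
    fix xs
    have "emeasure (distr N (count_space UNIV) ?V) {xs} = emeasure N (?V -` {xs} \<inter> space N)"
      by (rule emeasure_distr[OF V]) simp
    also have "\<dots> = ennreal (pmf (replicate_pmf n p) xs)"
      by (simp only: N.emeasure_eq_measure prob)
    finally show "emeasure (distr N (count_space UNIV) ?V) {xs} = emeasure (measure_pmf (replicate_pmf n p)) {xs}"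
      by (simp only: emeasure_pmf_single)
  qed auto
  then have "measure_pmf.prob (replicate_pmf n p) {xs. Q xs} = measure (distr N (count_space UNIV) ?V) {xs. Q xs}"
    by simp
  also have "\<dots> = measure N (?V -` {xs. Q xs} \<inter> space N)"
    by (rule measure_distr[OF V]) simp
  also have "?V -` {xs. Q xs} \<inter> space N = {\<omega> \<in> space N. Q (?V \<omega>)}" by auto
  finally show ?thesis by (simp only:)
qed

section \<open>Tails and truncated means of a law on the natural numbers\<close>

definition tail :: "nat pmf \<Rightarrow> nat \<Rightarrow> real" where
  "tail p k = measure_pmf.prob p {k..}"

definition trunc_mean :: "nat pmf \<Rightarrow> nat \<Rightarrow> real" where
  "trunc_mean p m = measure_pmf.expectation p (\<lambda>x. real (min x m))"

lemma tail_nonneg: "0 \<le> tail p k" by (simp add: tail_def)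

lemma tail_le_1: "tail p k \<le> 1" by (simp add: tail_def)

lemma tail_eq_expectation: "tail p k = measure_pmf.expectation p (indicator {k..})"
  by (simp add: tail_def)

lemma prob_below: "measure_pmf.prob p {..<k} = 1 - tail p k"
  using measure_pmf.prob_compl[of "{k..}" p] by (simp add: tail_def Compl_eq_Diff_UNIV[symmetric] not_le)

lemma integrable_min [simp, intro]: "integrable (measure_pmf p) (\<lambda>x. real (min x m))"
  by (rule integrable_bounded_pmf[where B = m]) auto

lemma integrable_indicator_pmf [simp, intro]: "integrable (measure_pmf p) (indicator S :: _ \<Rightarrow> real)"
  by (rule integrable_bounded_pmf[where B = 1]) (auto simp: indicator_def)

lemma trunc_mean_0: "trunc_mean p 0 = 0"
  by (simp add: trunc_mean_def)

lemma trunc_mean_Suc: "trunc_mean p (Suc m) = trunc_mean p m + tail p (Suc m)"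
proof -
  have "real (min x (Suc m)) = real (min x m) + indicator {Suc m..} x" for x
    by (auto simp: indicator_def min_def)
  then show ?thesis
    by (simp add: trunc_mean_def tail_eq_expectation del: min_Suc2)
qed

lemma trunc_mean_eq_sum: "trunc_mean p m = (\<Sum>k=1..m. tail p k)"
  by (induction m) (simp_all add: trunc_mean_0 trunc_mean_Suc)

lemma trunc_mean_diff: "t \<le> m \<Longrightarrow> trunc_mean p m - trunc_mean p t = (\<Sum>k\<in>{t<..m}. tail p k)"
proof (induction m rule: dec_induct)
  case (step m)
  have "{t<..Suc m} = insert (Suc m) {t<..m}" using step by auto
  then show ?case using step by (simp add: trunc_mean_Suc)
qed simp

lemma trunc_mean_mono: "m \<le> n \<Longrightarrow> trunc_mean p m \<le> trunc_mean p n"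
  using trunc_mean_diff[of m n p] sum_nonneg[of "{m<..n}" "tail p"] tail_nonneg by force

text \<open>
With tails of order \<open>C / k\<close> the truncated second moment grows only linearly in the truncation level. This
bounds the variances in the critical regime.
\<close>

lemma trunc_second_moment_le:
  assumes "\<And>k. real k * tail p k \<le> C"
  shows "measure_pmf.expectation p (\<lambda>x. (real (min x m))\<^sup>2) \<le> 2 * C * m"
proof (induction m)
  case (Suc m)
  have "(real (min x (Suc m)))\<^sup>2 = (real (min x m))\<^sup>2 + (2 * m + 1) * (indicator {Suc m..} x :: real)" for x
    by (auto simp: indicator_def min_def power2_eq_square algebra_simps not_le dest: le_antisym)
  moreover have "integrable (measure_pmf p) (\<lambda>x. (real (min x m))\<^sup>2)"
    by (rule integrable_bounded_pmf[where B = "m\<^sup>2"]) (auto intro!: power_mono)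
  ultimately have "measure_pmf.expectation p (\<lambda>x. (real (min x (Suc m)))\<^sup>2) =
      measure_pmf.expectation p (\<lambda>x. (real (min x m))\<^sup>2) + (2 * m + 1) * tail p (Suc m)"
    by (simp add: tail_eq_expectation del: min_Suc2)
  also have "real (2 * m + 1) * tail p (Suc m) \<le> 2 * (real (Suc m) * tail p (Suc m))"
    using tail_nonneg[of p "Suc m"] by (simp add: algebra_simps)
  also have "\<dots> \<le> 2 * C" using assms[of "Suc m"] by simp
  finally show ?case using Suc by (simp add: algebra_simps)
qed simp

lemma ln_le_sum_inverse:
  assumes "t \<le> n"
  shows "ln ((real n + 1) / (real t + 1)) \<le> (\<Sum>k\<in>{t<..n}. 1 / real k)"
  using assms
proof (induction n rule: dec_induct)
  case (step n)
  have "{t<..Suc n} = insert (Suc n) {t<..n}" using step by auto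
  moreover have "ln ((real (Suc n) + 1) / (real t + 1)) =
      ln ((real n + 1) / (real t + 1)) + ln (1 + 1 / (real n + 1))"
  proof -
    have "(real (Suc n) + 1) / (real t + 1) = (real n + 1) / (real t + 1) * (1 + 1 / (real n + 1))"
    proof -
      have "1 + 1 / (real n + 1) = (real (Suc n) + 1) / (real n + 1)" by (simp add: field_simps)
      then show ?thesis by simp
    qed
    moreover have "0 < (real n + 1) / (real t + 1)" "0 < 1 + 1 / (real n + 1)"
      by (auto intro!: divide_pos_pos add_pos_nonneg)
    ultimately show ?thesis by (simp only: ln_mult_pos)
  qed
  moreover have "ln (1 + 1 / (real n + 1)) \<le> 1 / (real n + 1)"
    by (rule ln_add_one_self_le_self) simp
  ultimately show ?case using step by (simp add: add.commute)
qed simp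

lemma sum_inverse_le_ln:
  assumes "1 \<le> t" "t \<le> n"
  shows "(\<Sum>k\<in>{t<..n}. 1 / real k) \<le> ln (real n / real t)"
  using assms(2)
proof (induction n rule: dec_induct)
  case base
  then show ?case using assms by simp
next
  case (step n)
  have n: "real n > 0" using step assms by simp
  have "{t<..Suc n} = insert (Suc n) {t<..n}" using step by auto
  moreover have "ln (real (Suc n) / real t) = ln (real n / real t) - ln (real n / (real n + 1))"
    using n assms(1) by (simp add: ln_div)
  moreover have "ln (real n / (real n + 1)) \<le> real n / (real n + 1) - 1"
    by (rule ln_le_minus_one) (use n in simp)
  moreover have "real n / (real n + 1) - 1 = - (1 / (real n + 1))"
    by (simp add: field_simps)
  ultimately show ?case using step by (simp add: add.commute)
qed

lemma trunc_mean_diff_le_ln: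
  assumes "1 \<le> t" "t \<le> n" "\<And>k. t < k \<Longrightarrow> k \<le> n \<Longrightarrow> real k * tail p k \<le> A" "0 \<le> A"
  shows "trunc_mean p n - trunc_mean p t \<le> A * ln (real n / real t)"
proof -
  have "(\<Sum>k\<in>{t<..n}. tail p k) \<le> (\<Sum>k\<in>{t<..n}. A * (1 / real k))"
    by (rule sum_mono) (use assms(1,3) in \<open>auto simp: field_simps\<close>)
  also have "\<dots> = A * (\<Sum>k\<in>{t<..n}. 1 / real k)" by (simp add: sum_distrib_left)
  also have "\<dots> \<le> A * ln (real n / real t)"
    by (rule mult_left_mono[OF sum_inverse_le_ln]) (use assms in auto)
  finally show ?thesis using trunc_mean_diff[OF assms(2)] by simp
qed


section \<open>Upper bounds from a single large degree and from parity\<close>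

definition graphical_prob :: "nat pmf \<Rightarrow> nat \<Rightarrow> real" where
  "graphical_prob p n = measure_pmf.prob (replicate_pmf n p) {xs. graphical xs}"

lemma graphical_prob_nonneg: "0 \<le> graphical_prob p n"
  by (simp add: graphical_prob_def)

lemma prob_replicate_mono:
  assumes "\<And>xs. length xs = n \<Longrightarrow> set xs \<subseteq> set_pmf p \<Longrightarrow> P xs \<Longrightarrow> Q xs"
  shows "measure_pmf.prob (replicate_pmf n p) {xs. P xs} \<le> measure_pmf.prob (replicate_pmf n p) {xs. Q xs}"
proof (rule measure_pmf.finite_measure_mono_AE)
  show "AE xs in replicate_pmf n p. xs \<in> {xs. P xs} \<longrightarrow> xs \<in> {xs. Q xs}"
  proof (rule AE_pmfI)
    fix xs assume "xs \<in> set_pmf (replicate_pmf n p)"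
    then have "length xs = n" "set xs \<subseteq> set_pmf p" by (auto simp: set_replicate_pmf)
    then show "xs \<in> {xs. P xs} \<longrightarrow> xs \<in> {xs. Q xs}" using assms by simp
  qed
qed simp

lemma prob_disj_le:
  "measure_pmf.prob p {x. P x \<or> Q x} \<le> measure_pmf.prob p {x. P x} + measure_pmf.prob p {x. Q x}"
  using measure_Un_le[of "{x. P x}" "measure_pmf p" "{x. Q x}"]
  by (simp add: Collect_disj_eq)

lemma power_one_minus_le_exp:
  assumes "0 \<le> x" "x \<le> (1::real)"
  shows "(1 - x) ^ n \<le> exp (- (real n * x))"
proof -
  have "(1 - x) ^ n \<le> exp (- x) ^ n"
    using exp_ge_add_one_self[of "- x"] assms by (intro power_mono) auto
  then show ?thesis by (simp add: exp_of_nat_mult[symmetric])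
qed

lemma graphical_prob_le_no_large:
  "graphical_prob p n \<le> exp (- (real n * tail p n))"
proof -
  have "graphical_prob p n \<le> measure_pmf.prob (replicate_pmf n p) {xs. set xs \<subseteq> {..<n}}"
    unfolding graphical_prob_def
    by (rule prob_replicate_mono) (use graphical_less_length in auto)
  also have "\<dots> = (1 - tail p n) ^ n"
    by (simp add: prob_all_replicate_pmf prob_below)
  also have "\<dots> \<le> exp (- (real n * tail p n))"
    by (rule power_one_minus_le_exp) (simp_all add: tail_nonneg tail_le_1)
  finally show ?thesis .
qed

lemma graphical_prob_tendsto_0_heavy:
  assumes "filterlim (\<lambda>n. real n * tail p n) at_top sequentially"
  shows "graphical_prob p \<longlonglongrightarrow> 0"
proof (rule tendsto_sandwich[of "\<lambda>_. 0"])
  show "(\<lambda>n. exp (- (real n * tail p n))) \<longlonglongrightarrow> 0"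
    by (rule filterlim_compose[OF exp_at_bot])
      (simp add: filterlim_uminus_at_bot assms)
qed (auto intro: always_eventually graphical_prob_nonneg graphical_prob_le_no_large)

text \<open>
A bound for the absolute value of all the signed expectations \<open>E (1\<^sub>S D (-1)^D)\<close>, uniformly in \<open>S\<close>.
It is less than one exactly when both parities occur.
\<close>

definition parity_bias :: "nat pmf \<Rightarrow> real" where
  "parity_bias p = max (measure_pmf.prob p {x. even x}) (measure_pmf.prob p {x. odd x})"

lemma parity_bias_nonneg: "0 \<le> parity_bias p"
  by (simp add: parity_bias_def le_max_iff_disj)

lemma prob_odd:
  fixes p :: "nat pmf"
  shows "measure_pmf.prob p {x. odd x} = 1 - measure_pmf.prob p {x. even x}"
proof -
  have *: "{x::nat. odd x} = UNIV - {x. even x}" by auto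
  have "measure_pmf.prob p (UNIV - {x. even x}) = 1 - measure_pmf.prob p {x. even x}"
    using measure_pmf.prob_compl[of "{x. even x}" p] by simp
  then show ?thesis by (simp only: *)
qed

lemma abs_signed_expectation_le:
  "\<bar>measure_pmf.expectation p (\<lambda>x. indicator S x * (-1) ^ x)\<bar> \<le> parity_bias p"
proof -
  have "indicator S x * (-1) ^ x \<le> (indicator {x. even x} x :: real)"
    "- indicator {x. odd x} x \<le> (indicator S x * (-1) ^ x :: real)" for x :: nat
    by (auto simp: indicator_def)
  moreover have "integrable (measure_pmf p) (\<lambda>x. indicator S x * (-1) ^ x :: real)"
    by (rule integrable_bounded_pmf[where B = 1]) (auto simp: indicator_def)
  moreover have "integrable (measure_pmf p) (\<lambda>x. - indicator {x. odd x} x :: real)" by simp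
  ultimately have
    "measure_pmf.expectation p (\<lambda>x. indicator S x * (-1) ^ x) \<le> measure_pmf.expectation p (indicator {x. even x} :: nat \<Rightarrow> real) \<and>
    measure_pmf.expectation p (\<lambda>x. - indicator {x. odd x} x :: real) \<le> measure_pmf.expectation p (\<lambda>x. indicator S x * (-1) ^ x)"
    by (intro conjI integral_mono integrable_indicator_pmf)
  then show ?thesis by (auto simp: parity_bias_def)
qed

lemma prob_even_bounds:
  "\<bar>measure_pmf.prob (replicate_pmf n p) {xs. even (sum_list xs)} - 1/2\<bar> \<le> parity_bias p ^ n / 2"
proof -
  have "\<bar>measure_pmf.expectation p (\<lambda>x. indicator UNIV x * (-1) ^ x) ^ n\<bar> \<le> parity_bias p ^ n"
    unfolding power_abs by (rule power_mono[OF abs_signed_expectation_le]) simp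
  moreover have *: "measure_pmf.prob (replicate_pmf n p) {xs. even (sum_list xs)} - 1/2 =
      measure_pmf.expectation p (\<lambda>x. indicator UNIV x * (-1) ^ x) ^ n / 2"
    using prob_all_even_replicate_pmf[of n p UNIV] by simp
  ultimately show ?thesis unfolding * by (simp only: abs_divide)
qed

text \<open>
A realizable sequence has an even sum and no entry that reaches \<open>n\<close>. The two requirements are asymptotically
independent because the signed expectation restricted to \<open>{..<n}\<close> stays away from one in absolute value.
\<close>

lemma graphical_prob_le_even:
  "graphical_prob p n \<le> (exp (- (real n * tail p n)) + parity_bias p ^ n) / 2"
proof -
  have "graphical_prob p n \<le>
      measure_pmf.prob (replicate_pmf n p) {xs. set xs \<subseteq> {..<n} \<and> even (sum_list xs)}"
    unfolding graphical_prob_def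
    by (rule prob_replicate_mono) (use graphical_less_length graphical_even in auto)
  also have "\<dots> = ((1 - tail p n) ^ n
      + measure_pmf.expectation p (\<lambda>x. indicator {..<n} x * (-1) ^ x) ^ n) / 2"
    by (simp add: prob_all_even_replicate_pmf prob_below)
  also have "(1 - tail p n) ^ n \<le> exp (- (real n * tail p n))"
    by (rule power_one_minus_le_exp) (simp_all add: tail_nonneg tail_le_1)
  also have "measure_pmf.expectation p (\<lambda>x. indicator {..<n} x * (-1) ^ x) ^ n \<le> parity_bias p ^ n"
    using power_mono[OF abs_signed_expectation_le[of p "{..<n}"] abs_ge_zero, of n]
    by (simp add: power_abs[symmetric])
  finally show ?thesis by simp
qed

text \<open>
With \<open>t\<close> of order \<open>n / j\<close>, rarely more than \<open>j\<close> entries reach \<open>t\<close>. Their sum is at least the sum of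
\<open>min x n - min x t\<close>, which is bounded and vanishes below \<open>t\<close>, so realizability then forces the sum of the
function \<open>f\<close> below to be at most zero, although its mean \<open>n * gap\<close> is positive.
\<close>

lemma graphical_prob_bound:
  assumes C: "\<And>k. real k * tail p k \<le> C" and t: "1 \<le> t" "t \<le> n" and j: "1 \<le> j"
    and jt: "4 * C * n \<le> real j * real t"
    and gap: "0 < trunc_mean p n - trunc_mean p t - trunc_mean p j" (is "0 < ?g")
  shows "graphical_prob p n \<le> 1 / j + (2 * C * n + j\<^sup>2) / (n * ?g\<^sup>2)"
proof -
  let ?r = "replicate_pmf n p"
  let ?f = "\<lambda>x. real (min x n) - real (min x t) - real (min x j)"
  let ?i = "indicator {t..} :: nat \<Rightarrow> real"
  have n: "0 < real n" using t by simp
  have Ef: "measure_pmf.expectation p ?f = ?g"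
    by (simp add: trunc_mean_def)
  have mins: "real (min x t) \<le> real (min x n)" "real (min x n) \<le> n" "real (min x j) \<le> j" for x
    using t(2) by auto
  have fb: "\<bar>?f x\<bar> \<le> n + j" for x using mins[of x] by (simp only: abs_le_iff) auto
  have f2: "(?f x)\<^sup>2 \<le> (real (min x n))\<^sup>2 + (real j)\<^sup>2" for x
  proof -
    have "\<bar>?f x\<bar> \<le> real (min x n) \<or> \<bar>?f x\<bar> \<le> real j"
      using mins[of x] by (simp only: abs_le_iff) linarith
    then show ?thesis
    proof
      assume "\<bar>?f x\<bar> \<le> real (min x n)"
      then have "(?f x)\<^sup>2 \<le> (real (min x n))\<^sup>2"
        by (simp only: abs_le_square_iff[symmetric] abs_of_nat)
      then show ?thesis by (simp add: add_increasing2)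
    next
      assume "\<bar>?f x\<bar> \<le> real j"
      then have "(?f x)\<^sup>2 \<le> (real j)\<^sup>2" by (simp only: abs_le_square_iff[symmetric] abs_of_nat)
      then show ?thesis by (simp add: add_increasing)
    qed
  qed
  have imin: "integrable p (\<lambda>x. (real (min x n))\<^sup>2)"
    by (rule integrable_bounded_pmf[where B = "n\<^sup>2"]) (auto intro!: power_mono)
  have "measure_pmf.expectation p (\<lambda>x. (?f x)\<^sup>2) \<le>
      measure_pmf.expectation p (\<lambda>x. (real (min x n))\<^sup>2 + (real j)\<^sup>2)"
  proof (rule integral_mono)
    show "integrable p (\<lambda>x. (?f x)\<^sup>2)"
    proof (rule integrable_bounded_pmf[where B = "n\<^sup>2 + j\<^sup>2"])
      fix x
      have "(real (min x n))\<^sup>2 \<le> (real n)\<^sup>2" by (rule power_mono) auto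
      then have "(?f x)\<^sup>2 \<le> (real n)\<^sup>2 + (real j)\<^sup>2" using f2[of x] by linarith
      then show "\<bar>(?f x)\<^sup>2\<bar> \<le> real (n\<^sup>2 + j\<^sup>2)"
        by (simp only: abs_power2 of_nat_add of_nat_power)
    qed
  qed (use imin f2 in auto)
  also have "\<dots> \<le> 2 * C * n + (real j)\<^sup>2"
    using imin trunc_second_moment_le[of p C n] C by simp
  finally have Ef2: "measure_pmf.expectation p (\<lambda>x. (?f x)\<^sup>2) \<le> 2 * C * n + (real j)\<^sup>2" .
  have nT: "n * tail p t \<le> j / 4"
  proof -
    have "real t * (n * tail p t) \<le> n * C"
      using C[of t] mult_left_mono[of "t * tail p t" C n] by (simp add: algebra_simps)
    also have "\<dots> \<le> real t * (j / 4)" using jt by (simp add: algebra_simps)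
    finally show ?thesis using t by simp
  qed
  have "graphical_prob p n \<le> measure_pmf.prob ?r
      {xs. \<bar>sum_list (map ?i xs) - n * tail p t\<bar> \<ge> 3 / 4 * j \<or> \<bar>sum_list (map ?f xs) - n * ?g\<bar> \<ge> n * ?g}"
    unfolding graphical_prob_def
  proof (rule prob_replicate_mono)
    fix xs assume len: "length xs = n" and g: "graphical xs"
    have cnt: "sum_list (map ?i xs) = length (filter (\<lambda>x. t \<le> x) xs)"
      by (induction xs) (auto simp: indicator_def)
    show "\<bar>sum_list (map ?i xs) - n * tail p t\<bar> \<ge> 3 / 4 * j \<or> \<bar>sum_list (map ?f xs) - n * ?g\<bar> \<ge> n * ?g"
    proof (cases "length (filter (\<lambda>x. t \<le> x) xs) \<le> j")
      case True
      have "real (sum_list (filter (\<lambda>x. t \<le> x) xs)) \<le> real (sum_list (map (min j) xs))"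
        using graphical_large_entries[OF g True] by (simp only: of_nat_le_iff)
      moreover have "real (sum_list (map (min j) xs)) + sum_list (map ?f xs) \<le> real (sum_list (filter (\<lambda>x. t \<le> x) xs))"
        by (induction xs) (auto simp: min_def)
      ultimately show ?thesis using gap n by (simp add: abs_if)
    next
      case False
      then have "sum_list (map ?i xs) \<ge> j" unfolding cnt by simp
      then show ?thesis using nT by linarith
    qed
  qed
  also have "\<dots> \<le> measure_pmf.prob ?r {xs. \<bar>sum_list (map ?i xs) - n * tail p t\<bar> \<ge> 3 / 4 * j}
      + measure_pmf.prob ?r {xs. \<bar>sum_list (map ?f xs) - n * ?g\<bar> \<ge> n * ?g}"
    by (rule prob_disj_le)
  also have "measure_pmf.prob ?r {xs. \<bar>sum_list (map ?i xs) - n * tail p t\<bar> \<ge> 3 / 4 * j} \<le> 1 / j"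
  proof -
    have "measure_pmf.prob ?r {xs. \<bar>sum_list (map ?i xs) - n * tail p t\<bar> \<ge> 3 / 4 * j}
        \<le> n * measure_pmf.expectation p (\<lambda>x. (?i x)\<^sup>2) / (3 / 4 * j)\<^sup>2"
      unfolding tail_eq_expectation
      by (rule Chebyshev_replicate_pmf[where B = 1]) (use j in \<open>auto simp: indicator_def\<close>)
    also have "(\<lambda>x. (?i x)\<^sup>2) = ?i" by (auto simp: indicator_def)
    also have "n * measure_pmf.expectation p ?i / (3 / 4 * j)\<^sup>2 \<le> (j / 4) / (3 / 4 * j)\<^sup>2"
      using nT by (intro divide_right_mono) (simp_all add: tail_eq_expectation)
    also have "\<dots> \<le> 1 / j" using j by (simp add: power2_eq_square field_simps)
    finally show ?thesis .
  qed
  also have "measure_pmf.prob ?r {xs. \<bar>sum_list (map ?f xs) - n * ?g\<bar> \<ge> n * ?g}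
      \<le> n * measure_pmf.expectation p (\<lambda>x. (?f x)\<^sup>2) / (n * ?g)\<^sup>2"
    unfolding Ef[symmetric]
    by (rule Chebyshev_replicate_pmf[where B = "n + j"]) (use fb gap n in \<open>auto simp: Ef simp del: of_nat_add\<close>)
  also have "\<dots> \<le> n * (2 * C * n + (real j)\<^sup>2) / (n * ?g)\<^sup>2"
    using Ef2 by (intro divide_right_mono mult_left_mono) auto
  also have "\<dots> = (2 * C * n + j\<^sup>2) / (n * ?g\<^sup>2)"
    using n by (simp add: power2_eq_square)
  finally show ?thesis by simp
qed

section \<open>The critical tail with divergent deficit\<close>

lemma sum_inverse_upper:
  assumes "1 \<le> m"
  shows "(\<Sum>k=1..m. 1 / real k) \<le> 1 + ln (real m)"
proof -
  have "{1..m} = insert 1 {1<..m}" using assms by auto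
  then show ?thesis using sum_inverse_le_ln[of 1 m] assms by simp
qed

lemma sum_inverse_lower:
  assumes "1 \<le> m"
  shows "ln (real m) \<le> (\<Sum>k=1..m. 1 / real k)"
proof -
  have "{1..m} = {0<..m}" by auto
  moreover have "ln (real m) \<le> ln (real m + 1)" using assms by simp
  ultimately show ?thesis using ln_le_sum_inverse[of 0 m] by simp
qed

lemma trunc_mean_harmonic:
  "trunc_mean p m = c * (\<Sum>k=1..m. 1 / real k) - (\<Sum>k=1..m. c / real k - tail p k)"
  by (simp add: trunc_mean_eq_sum sum_subtractf sum_distrib_left)

lemma bounded_scaled_tail:
  assumes "(\<lambda>n. real n * tail p n) \<longlonglongrightarrow> c"
  obtains C where "0 < C" "\<And>k. real k * tail p k \<le> C"
proof -
  have "Bseq (\<lambda>n. real n * tail p n)"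
    using assms by (intro convergent_imp_Bseq convergentI)
  then obtain K where K: "0 < K" "\<And>n. norm (real n * tail p n) \<le> K" by (auto elim: BseqE)
  have "real k * tail p k \<le> K" for k using K(2)[of k] by (simp only: real_norm_def abs_le_iff)
  then show ?thesis using that K(1) by blast
qed

text \<open>
For fixed \<open>j\<close> and \<open>t\<close> close to \<open>4 C n / j\<close>, the gap in \<open>graphical_prob_bound\<close> is at least the deficit
\<open>G j\<close> minus a constant \<open>K\<close> that does not depend on \<open>j\<close>. Letting first \<open>n\<close> and then \<open>j\<close> grow gives the
claim, since \<open>G j\<close> is unbounded.
\<close>

lemma graphical_prob_tendsto_0_critical:
  assumes c: "0 < c" and lim: "(\<lambda>n. real n * tail p n) \<longlonglongrightarrow> c"
    and div: "filterlim (\<lambda>m. \<Sum>k=1..m. c / real k - tail p k) at_top sequentially"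
  shows "graphical_prob p \<longlonglongrightarrow> 0"
proof -
  obtain C where C: "0 < C" "\<And>k. real k * tail p k \<le> C" using bounded_scaled_tail[OF lim] by blast
  define G where "G = (\<lambda>m. \<Sum>k=1..m. c / real k - tail p k)"
  define K where "K = 2 * c + c * \<bar>ln (8 * C)\<bar>"
  have "eventually (\<lambda>n. graphical_prob p n < e) sequentially" if e: "0 < e" for e
  proof -
    define B where "B = max 1 (3 * (2 * C + 1) / e)"
    have B: "1 \<le> B" "(2 * C + 1) / B\<^sup>2 \<le> e / 3"
    proof -
      show "1 \<le> B" by (simp add: B_def)
      then have "B \<le> B\<^sup>2" by (simp add: power2_eq_square)
      moreover have "3 * (2 * C + 1) / e \<le> B" by (simp add: B_def)
      ultimately have "3 * (2 * C + 1) / e \<le> B\<^sup>2" by linarith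
      then show "(2 * C + 1) / B\<^sup>2 \<le> e / 3" using \<open>1 \<le> B\<close> e by (simp add: field_simps)
    qed
    have "eventually (\<lambda>j. K + B \<le> G j) sequentially"
      using div by (simp add: G_def filterlim_at_top)
    moreover have "eventually (\<lambda>j. max (max 1 (3 / e + 1)) (8 * C) \<le> real j) sequentially"
      using filterlim_real_sequentially by (simp only: filterlim_at_top)
    ultimately have "eventually (\<lambda>j. K + B \<le> G j \<and> max (max 1 (3 / e + 1)) (8 * C) \<le> real j) sequentially"
      by (rule eventually_conj)
    then obtain j :: nat where j: "K + B \<le> G j" "1 \<le> real j" "3 / e + 1 \<le> real j" "8 * C \<le> real j"
      by (auto dest!: eventually_happens)
    \<comment> \<open>The tail is only known to be c / k up to a factor close to one. An error d in the constant costs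
      d * ln j in the demand, which this choice keeps below c.\<close>
    define d where "d = c / (1 + ln (real j))"
    have lnj: "0 \<le> ln (real j)" using j(2) by simp
    have d: "0 < d" "d \<le> c" "d * ln (real j) \<le> c"
      using c lnj by (auto simp: d_def field_simps)
    have "eventually (\<lambda>k. c - d < real k * tail p k) sequentially"
      using order_tendstoD(1)[OF lim, of "c - d"] d by simp
    then obtain N where N: "\<And>k. N \<le> k \<Longrightarrow> c - d < real k * tail p k"
      by (auto simp: eventually_sequentially)
    have Hj: "trunc_mean p j \<le> c * (1 + ln (real j)) - G j"
      using sum_inverse_upper[of j] j(2) c trunc_mean_harmonic[of p j c] by (simp add: G_def)
    have "eventually (\<lambda>n. max (max 2 ((real j)\<^sup>2)) (max (2 * j / (4 * C)) (N * j / (4 * C))) \<le> real n) sequentially"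
      using filterlim_real_sequentially by (simp only: filterlim_at_top)
    then show ?thesis
    proof eventually_elim
      case (elim n)
      then have n: "2 \<le> real n" "(real j)\<^sup>2 \<le> n" "2 * j / (4 * C) \<le> n" "N * j / (4 * C) \<le> n" by auto
      have n': "2 * j \<le> 4 * C * n" "N * j \<le> 4 * C * n" using n(3,4) C(1) by (simp_all add: field_simps)
      define t where "t = nat \<lceil>4 * C * n / j\<rceil>"
      have pos: "0 < 4 * C * n / j" using C n j by (intro divide_pos_pos mult_pos_pos) auto
      have t1: "4 * C * n / j \<le> t" "real t \<le> 4 * C * n / j + 1"
        using pos unfolding t_def by linarith+
      have t: "1 \<le> t" using t1 pos by (cases t) auto
      have half: "4 * C * n / j \<le> n / 2"
      proof -
        have "8 * C * real n \<le> real j * real n" using j(4) by (intro mult_right_mono) auto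
        then show ?thesis using j(2) by (simp add: field_simps)
      qed
      have tn: "t \<le> n"
      proof -
        have "real t \<le> n / 2 + 1" using half t1(2) by linarith
        then show ?thesis using n(1) by linarith
      qed
      have tN: "N \<le> t"
      proof -
        have "real N \<le> 4 * C * n / j" using n'(2) j(2) by (simp add: field_simps)
        then show ?thesis using t1(1) by linarith
      qed
      have jt: "4 * C * n \<le> real j * real t" using t1(1) j(2) by (simp add: field_simps)
      have "j / (8 * C) \<le> (real n + 1) / (real t + 1)"
      proof -
        have "1 \<le> 2 * C * n / j" using n'(1) j(2) by (simp add: field_simps)
        then have "real t + 1 \<le> 8 * C * n / j" using t1(2) n'(1) j(2) by (simp add: field_simps)
        then have "(real t + 1) * j \<le> 8 * C * n" using j(2) by (simp add: field_simps)
        also have "\<dots> \<le> 8 * C * (n + 1)" using C by simp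
        finally show ?thesis using C by (simp add: field_simps)
      qed
      then have "ln (j / (8 * C)) \<le> ln ((real n + 1) / (real t + 1))"
        using C j(2) by (intro ln_mono) auto
      then have lnjt: "ln j - ln (8 * C) \<le> ln ((real n + 1) / (real t + 1))"
        using C j(2) by (simp add: ln_div)
      have "(c - d) * (ln j - ln (8 * C)) \<le> (c - d) * (\<Sum>k\<in>{t<..n}. 1 / real k)"
        using lnjt ln_le_sum_inverse[OF tn] d by (intro mult_left_mono) auto
      also have "\<dots> = (\<Sum>k\<in>{t<..n}. (c - d) / real k)" by (simp add: sum_distrib_left)
      also have "\<dots> \<le> (\<Sum>k\<in>{t<..n}. tail p k)"
      proof (rule sum_mono)
        fix k assume "k \<in> {t<..n}"
        then have "N \<le> k" "0 < real k" using tN by auto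
        then show "(c - d) / real k \<le> tail p k"
          using N[of k] by (simp add: field_simps)
      qed
      also have "\<dots> = trunc_mean p n - trunc_mean p t" using trunc_mean_diff[OF tn] by simp
      finally have 1: "(c - d) * (ln j - ln (8 * C)) \<le> trunc_mean p n - trunc_mean p t" .
      have "(c - d) * ln (8 * C) \<le> c * \<bar>ln (8 * C)\<bar>"
      proof -
        have "(c - d) * ln (8 * C) \<le> (c - d) * \<bar>ln (8 * C)\<bar>"
          using d by (intro mult_left_mono) auto
        also have "\<dots> \<le> c * \<bar>ln (8 * C)\<bar>" using d by (intro mult_right_mono) auto
        finally show ?thesis .
      qed
      then have "c * ln j - c - c * \<bar>ln (8 * C)\<bar> \<le> (c - d) * (ln j - ln (8 * C))"
        using d(3) by (simp add: algebra_simps)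
      then have gap: "B \<le> trunc_mean p n - trunc_mean p t - trunc_mean p j" (is "B \<le> ?g")
        using 1 Hj j(1) by (simp add: K_def algebra_simps)
      then have gpos: "0 < ?g" using B(1) by linarith
      have "graphical_prob p n \<le> 1 / j + (2 * C * n + j\<^sup>2) / (n * ?g\<^sup>2)"
        using graphical_prob_bound[OF C(2) t tn _ jt gpos] j(2) by simp
      also have "(2 * C * n + j\<^sup>2) / (n * ?g\<^sup>2) \<le> (2 * C * n + n) / (n * B\<^sup>2)"
        by (rule frac_le) (use n C B gap in \<open>auto intro!: mult_left_mono power_mono\<close>)
      also have "\<dots> = (2 * C + 1) / B\<^sup>2"
      proof -
        have "2 * C * n + n = n * (2 * C + 1)" by (simp add: algebra_simps)
        then show ?thesis using n(1) by (simp only: mult_divide_mult_cancel_left)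
      qed
      also have "\<dots> \<le> e / 3" by (rule B(2))
      also have "1 / real j \<le> e / 3"
      proof -
        have "3 / e \<le> real j" using j(3) by linarith
        then show ?thesis using e j(2) by (simp add: field_simps)
      qed
      finally show ?case using e by simp
    qed
  qed
  then show ?thesis
    by (auto simp: tendsto_iff dist_real_def abs_of_nonneg graphical_prob_nonneg)
qed


section \<open>Domination and the limit one half\<close>

definition undominated_prob :: "nat pmf \<Rightarrow> nat \<Rightarrow> real" where
  "undominated_prob p n = measure_pmf.prob (replicate_pmf n p) {xs. \<exists>j\<in>{1..n}. \<not> dominated xs j}"

lemma undominated_prob_nonneg: "0 \<le> undominated_prob p n"
  by (simp add: undominated_prob_def)

lemma graphical_prob_ge:
  "measure_pmf.prob (replicate_pmf n p) {xs. even (sum_list xs)} - undominated_prob p n \<le> graphical_prob p n"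
proof -
  have "measure_pmf.prob (replicate_pmf n p) {xs. even (sum_list xs)} \<le>
      measure_pmf.prob (replicate_pmf n p) {xs. graphical xs \<or> (\<exists>j\<in>{1..n}. \<not> dominated xs j)}"
    by (rule prob_replicate_mono) (use graphical_if_dominated in fastforce)
  also have "\<dots> \<le> graphical_prob p n + undominated_prob p n"
    unfolding graphical_prob_def undominated_prob_def by (rule prob_disj_le)
  finally show ?thesis by simp
qed

lemma graphical_prob_tendsto_half:
  assumes bias: "parity_bias p < 1" and bad: "undominated_prob p \<longlonglongrightarrow> 0"
  shows "graphical_prob p \<longlonglongrightarrow> 1/2"
proof (rule tendsto_sandwich)
  have pow: "(\<lambda>n. parity_bias p ^ n) \<longlonglongrightarrow> 0"
    using bias parity_bias_nonneg by (intro LIMSEQ_realpow_zero) auto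
  show "(\<lambda>n. 1/2 - parity_bias p ^ n / 2 - undominated_prob p n) \<longlonglongrightarrow> 1/2"
    using tendsto_diff[OF tendsto_diff[OF tendsto_const[of "1/2"] tendsto_divide[OF pow tendsto_const[of 2]]] bad]
    by simp
  show "(\<lambda>n. 1/2 + parity_bias p ^ n / 2) \<longlonglongrightarrow> 1/2"
    using tendsto_add[OF tendsto_const[of "1/2"] tendsto_divide[OF pow tendsto_const[of 2]]] by simp
  show "\<forall>\<^sub>F n in sequentially. 1/2 - parity_bias p ^ n / 2 - undominated_prob p n \<le> graphical_prob p n"
  proof (rule always_eventually, rule allI)
    fix n
    show "1/2 - parity_bias p ^ n / 2 - undominated_prob p n \<le> graphical_prob p n"
      using graphical_prob_ge[of n p] prob_even_bounds[of n p] unfolding abs_le_iff by linarith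
  qed
  show "\<forall>\<^sub>F n in sequentially. graphical_prob p n \<le> 1/2 + parity_bias p ^ n / 2"
  proof (rule always_eventually, rule allI)
    fix n
    have "graphical_prob p n \<le> measure_pmf.prob (replicate_pmf n p) {xs. even (sum_list xs)}"
      unfolding graphical_prob_def by (rule prob_replicate_mono) (rule graphical_even)
    then show "graphical_prob p n \<le> 1/2 + parity_bias p ^ n / 2"
      using prob_even_bounds[of n p] unfolding abs_le_iff by linarith
  qed
qed

lemma real_sum_list_map: "real (sum_list (map f xs)) = sum_list (map (\<lambda>x. real (f x)) xs)"
  by (induction xs) auto

lemma dominatedI_threshold:
  assumes "real j * real t + sum_list (map (\<lambda>x. real (x - t)) xs) + real j \<le> sum_list (map (\<lambda>x. real (min x j)) xs)"
  shows "dominated xs j"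
proof -
  have "real (j * t + sum_list (map (\<lambda>x. x - t) xs) + j) \<le> real (sum_list (map (min j) xs))"
    using assms by (simp add: real_sum_list_map min.commute)
  then show ?thesis unfolding dominated_def of_nat_le_iff by blast
qed

lemma dominatedI_sum:
  assumes "sum_list (map real xs) \<le> y * (y - 1)" "1 \<le> y" "y \<le> real j"
  shows "dominated xs j"
proof -
  have "y * (y - 1) \<le> real j * (real j - 1)"
    using assms by (intro mult_mono) auto
  moreover have "real (sum_list xs) = sum_list (map real xs)"
    using real_sum_list_map[of "\<lambda>x. x" xs] by simp
  moreover have "real (j * (j - 1)) = real j * (real j - 1)"
    using assms by (cases j) (auto simp: algebra_simps)
  ultimately have "real (sum_list xs) \<le> real (j * (j - 1))" using assms(1) by linarith
  then show ?thesis unfolding dominated_def of_nat_le_iff by blast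
qed

lemma length_le_sum_min:
  assumes "\<And>x. x \<in> set xs \<Longrightarrow> 1 \<le> x" "1 \<le> j"
  shows "real (length xs) \<le> sum_list (map (\<lambda>x. real (min x j)) xs)"
  using assms
proof (induction xs)
  case (Cons x xs)
  have "1 \<le> real (min x j)" using Cons.prems by simp
  moreover have "real (length xs) \<le> sum_list (map (\<lambda>x. real (min x j)) xs)" using Cons by simp
  moreover have "real (length (x # xs)) = 1 + real (length xs)" by simp
  ultimately show ?case unfolding list.map sum_list.Cons by linarith
qed simp

lemma prob_some_large:
  "measure_pmf.prob (replicate_pmf n p) {xs. \<exists>x\<in>set xs. k \<le> x} \<le> n * tail p k"
proof -
  have "1 \<le> sum_list (map (indicator {k..}) xs :: real list)" if "\<exists>x\<in>set xs. k \<le> x" for xs :: "nat list"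
    using that
  proof (induction xs)
    case (Cons x xs)
    have "0 \<le> sum_list (map (\<lambda>x. of_bool (k \<le> x)) xs :: real list)" by (rule sum_list_nonneg) auto
    then show ?case using Cons by (auto simp: indicator_def)
  qed simp
  then have "measure_pmf.prob (replicate_pmf n p) {xs. \<exists>x\<in>set xs. k \<le> x} \<le>
      measure_pmf.prob (replicate_pmf n p) {xs. 1 \<le> sum_list (map (indicator {k..}) xs :: real list)}"
    by (intro prob_replicate_mono) auto
  also have "\<dots> \<le> n * measure_pmf.expectation p (indicator {k..}) / 1"
    by (rule Markov_replicate_pmf) auto
  finally show ?thesis by (simp add: tail_def)
qed

lemma trunc_mean_incseq: "incseq (trunc_mean p)"
  by (simp add: incseq_def trunc_mean_mono)

lemma trunc_mean_tendsto:
  assumes "integrable (measure_pmf p) real"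
  shows "trunc_mean p \<longlonglongrightarrow> measure_pmf.expectation p real"
  unfolding trunc_mean_def
proof (rule integral_dominated_convergence[where w = real])
  show "AE x in measure_pmf p. (\<lambda>i. real (min x i)) \<longlonglongrightarrow> real x"
  proof (rule AE_pmfI)
    fix x
    have "\<forall>\<^sub>F i in sequentially. real (min x i) = real x"
      using eventually_ge_at_top[of x] by eventually_elim simp
    then show "(\<lambda>i. real (min x i)) \<longlonglongrightarrow> real x" by (rule tendsto_eventually)
  qed
qed (use assms in auto)

lemma integrable_if_trunc_mean_bounded:
  assumes "\<And>m. trunc_mean p m \<le> L"
  shows "integrable (measure_pmf p) real"
proof -
  obtain l where "trunc_mean p \<longlonglongrightarrow> l"
    using incseq_convergent[OF trunc_mean_incseq] assms by blast
  then show ?thesis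
    unfolding trunc_mean_def
  proof (rule integrable_monotone_convergence[rotated 3])
    show "AE x in measure_pmf p. (\<lambda>i. real (min x i)) \<longlonglongrightarrow> real x"
    proof (rule AE_pmfI)
      fix x
      have "\<forall>\<^sub>F i in sequentially. real (min x i) = real x"
        using eventually_ge_at_top[of x] by eventually_elim simp
      then show "(\<lambda>i. real (min x i)) \<longlonglongrightarrow> real x" by (rule tendsto_eventually)
    qed
  qed (auto intro!: AE_pmfI simp: mono_def)
qed

text \<open>
A level \<open>A\<close> with small expected excess \<open>E (D - A)\<close> serves as threshold for all \<open>j \<le> d n\<close>: the excess sum rarely
reaches \<open>n / 2\<close>, \<open>j * (A + 1)\<close> is at most \<open>n / 2\<close>, and the capacity is at least \<open>n\<close> because degrees are
positive. For \<open>j > d n\<close> the total degree, of order \<open>n\<close>, is below \<open>j * (j - 1)\<close>.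
\<close>

lemma undominated_prob_tendsto_0_integrable:
  assumes int: "integrable (measure_pmf p) real" and pos: "\<And>x. x \<in> set_pmf p \<Longrightarrow> 1 \<le> x"
  shows "undominated_prob p \<longlonglongrightarrow> 0"
proof -
  let ?m = "measure_pmf.expectation p real"
  have "eventually (\<lambda>n. undominated_prob p n < e) sequentially" if e: "0 < e" for e
  proof -
    have "eventually (\<lambda>A. ?m - e / 4 < trunc_mean p A) sequentially"
      by (rule order_tendstoD(1)[OF trunc_mean_tendsto[OF int]]) (use e in simp)
    then obtain A where "?m - e / 4 < trunc_mean p A"
      by (auto dest!: eventually_happens)
    then have A: "?m - trunc_mean p A < e / 4" by linarith
    have EA: "measure_pmf.expectation p (\<lambda>x. real (x - A)) = ?m - trunc_mean p A"
    proof -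
      have "(\<lambda>x. real (x - A)) = (\<lambda>x. real x - real (min x A))" by (auto simp: min_def)
      then show ?thesis using int by (simp add: trunc_mean_def)
    qed
    have iA: "integrable p (\<lambda>x. real (x - A))"
      by (rule Bochner_Integration.integrable_bound[OF int]) auto
    define d where "d = 1 / (2 * (real A + 1))"
    have d: "0 < d" "d * (real A + 1) = 1 / 2" by (auto simp: d_def)
    have "eventually (\<lambda>n. ?m * (real n / (d * real n * (d * real n - 1))) < e / 2) sequentially"
    proof (rule order_tendstoD(2))
      have "(\<lambda>n. real n / (d * real n * (d * real n - 1))) \<longlonglongrightarrow> 0"
        using d(1) by real_asymp
      then show "(\<lambda>n. ?m * (real n / (d * real n * (d * real n - 1)))) \<longlonglongrightarrow> 0"
        by (rule tendsto_mult_right_zero)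
    qed (use e in simp)
    moreover have "eventually (\<lambda>n. 2 \<le> d * real n) sequentially"
      using d(1) by real_asymp
    ultimately show ?thesis
    proof eventually_elim
      case (elim n)
      have n: "0 < real n" using elim(2) by (cases n) auto
      have "undominated_prob p n \<le> measure_pmf.prob (replicate_pmf n p)
          {xs. real n / 2 \<le> sum_list (map (\<lambda>x. real (x - A)) xs) \<or> d * n * (d * n - 1) \<le> sum_list (map real xs)}"
        unfolding undominated_prob_def
      proof (rule prob_replicate_mono, rule ccontr)
        fix xs assume len: "length xs = n" and supp: "set xs \<subseteq> set_pmf p"
          and ex: "\<exists>j\<in>{1..n}. \<not> dominated xs j"
          and no: "\<not> (real n / 2 \<le> sum_list (map (\<lambda>x. real (x - A)) xs) \<or> d * n * (d * n - 1) \<le> sum_list (map real xs))"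
        obtain j where j: "1 \<le> j" "\<not> dominated xs j" using ex by auto
        show False
        proof (cases "real j \<le> d * n")
          case True
          have "real n \<le> sum_list (map (\<lambda>x. real (min x j)) xs)"
            using length_le_sum_min[of xs j] pos supp len j by auto
          moreover have "real j * (real A + 1) \<le> n / 2"
          proof -
            have "real j * (real A + 1) \<le> (d * n) * (real A + 1)" using True by (intro mult_right_mono) auto
            also have "\<dots> = n * (d * (real A + 1))" by simp
            finally show ?thesis by (simp add: d(2))
          qed
          ultimately have "dominated xs j"
            by (intro dominatedI_threshold[where t = A]) (use no in \<open>simp add: algebra_simps\<close>)
          then show False using j by simp
        next
          case False
          then have "dominated xs j"
            by (intro dominatedI_sum[where y = "d * n"]) (use no elim(2) in auto)
          then show False using j by simp
        qed
      qed
      also have "\<dots> \<le> measure_pmf.prob (replicate_pmf n p) {xs. real n / 2 \<le> sum_list (map (\<lambda>x. real (x - A)) xs)}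
          + measure_pmf.prob (replicate_pmf n p) {xs. d * n * (d * n - 1) \<le> sum_list (map real xs)}"
        by (rule prob_disj_le)
      also have "measure_pmf.prob (replicate_pmf n p) {xs. real n / 2 \<le> sum_list (map (\<lambda>x. real (x - A)) xs)}
          \<le> n * (?m - trunc_mean p A) / (n / 2)"
        unfolding EA[symmetric] by (rule Markov_replicate_pmf[OF iA]) (use n in auto)
      also have "\<dots> = 2 * (?m - trunc_mean p A)" using n by simp
      also have "\<dots> \<le> e / 2" using A by simp
      also have "measure_pmf.prob (replicate_pmf n p) {xs. d * n * (d * n - 1) \<le> sum_list (map real xs)}
          \<le> n * ?m / (d * n * (d * n - 1))"
        by (rule Markov_replicate_pmf[OF int]) (use elim(2) n d in auto)
      also have "n * ?m / (d * n * (d * n - 1)) = ?m * (real n / (d * real n * (d * real n - 1)))"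
        by (simp only: times_divide_eq_right mult.commute)
      finally show ?case using elim(1) by linarith
    qed
  qed
  then show ?thesis
    by (auto simp: tendsto_iff dist_real_def abs_of_nonneg undominated_prob_nonneg)
qed

text \<open>
The excess over the integer part \<open>t\<close> of \<open>n powr (1/3)\<close>, truncated at \<open>n\<close>, has mean at most
\<open>C * ln (n / t) / ln t \<le> 3 * C\<close>, so its sum rarely reaches \<open>L n\<close> for large \<open>L\<close>, while the infinite mean makes the capacity at a fixed \<open>j0\<close> exceed \<open>n (L + 2)\<close> for any given \<open>L\<close>. This settles
\<open>j0 < j \<le> n powr (2/3)\<close>. Below \<open>j0\<close> it is enough that no degree is comparable to \<open>n\<close>, and above
\<open>n powr (2/3)\<close> that the total degree is of order \<open>n ln n\<close>.
\<close>

lemma undominated_prob_tendsto_0_log: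
  assumes pos: "\<And>x. x \<in> set_pmf p \<Longrightarrow> 1 \<le> x"
    and C: "0 \<le> C" "\<And>n. 2 \<le> n \<Longrightarrow> real n * ln (real n) * tail p n \<le> C"
    and nint: "\<not> integrable (measure_pmf p) real"
  shows "undominated_prob p \<longlonglongrightarrow> 0"
proof -
  have scaled: "real k * tail p k \<le> C / ln (real t)" if "2 \<le> t" "t \<le> k" for t k
  proof -
    have "0 < ln (real t)" "ln (real t) \<le> ln (real k)" using that by auto
    moreover have "real k * tail p k \<le> C / ln (real k)"
      using C(2)[of k] that \<open>0 < ln (real t)\<close> \<open>ln (real t) \<le> ln (real k)\<close> by (simp add: field_simps)
    ultimately show ?thesis using C(1) by (meson divide_left_mono mult_pos_pos order_less_le_trans order_trans)
  qed
  have mean_log: "trunc_mean p n \<le> 1 + 2 * C * ln (real n)" if n: "1 \<le> n" for n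
  proof -
    have half: "1 / 2 \<le> ln (2::real)" using ln2_ge_two_thirds by simp
    have "C / ln (real 2) \<le> 2 * C" using half C(1) mult_left_mono[OF half, of "2 * C"] by (simp add: field_simps)
    then have "trunc_mean p n - trunc_mean p 1 \<le> 2 * C * ln (real n / real 1)"
    proof (intro trunc_mean_diff_le_ln)
      show "real k * tail p k \<le> 2 * C" if "1 < k" for k
        using scaled[of 2 k] that \<open>C / ln (real 2) \<le> 2 * C\<close> by linarith
    qed (use n C(1) in auto)
    moreover have "trunc_mean p 1 \<le> 1"
      using trunc_mean_Suc[of p 0] by (simp add: trunc_mean_0 tail_le_1)
    ultimately show ?thesis by simp
  qed
  have "eventually (\<lambda>n. undominated_prob p n < e) sequentially" if e: "0 < e" for e
  proof -
    \<comment> \<open>Markov's inequality bounds the probability that the excess sum reaches L * n by 3 * C / L.\<close>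
    define L where "L = 15 * C / e + 1"
    have L: "0 < L" "3 * C / L \<le> e / 5" using C(1) e by (auto simp: L_def field_simps add_pos_nonneg)
    obtain j0 where j0: "L + 3 < trunc_mean p j0"
      using integrable_if_trunc_mean_bounded[of p "L + 3"] nint by (meson not_le)
    have j01: "1 \<le> j0" using j0 L by (cases j0) (auto simp: trunc_mean_0)
    define t where "t = (\<lambda>n::nat. nat \<lfloor>real n powr (1/3)\<rfloor>)"
    define k where "k = (\<lambda>n::nat. nat \<lceil>real n / (2 * j0)\<rceil>)"
    have "eventually (\<lambda>n. 2 * j0 * C / ln (real n / (2 * j0)) < e / 5) sequentially"
    proof (rule order_tendstoD(2))
      show "(\<lambda>n. 2 * j0 * C / ln (real n / (2 * j0))) \<longlonglongrightarrow> 0" using j01 by real_asymp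
    qed (use e in simp)
    moreover have "eventually (\<lambda>n. real j0 ^ 2 / real n < e / 5) sequentially"
    proof (rule order_tendstoD(2))
      show "(\<lambda>n. real j0 ^ 2 / real n) \<longlonglongrightarrow> 0" by real_asymp
    qed (use e in simp)
    moreover have "eventually (\<lambda>n. real n * (1 + 2 * C * ln (real n)) /
        (real n powr (2/3) * (real n powr (2/3) - 1)) < e / 5) sequentially"
    proof (rule order_tendstoD(2))
      show "(\<lambda>n. real n * (1 + 2 * C * ln (real n)) / (real n powr (2/3) * (real n powr (2/3) - 1))) \<longlonglongrightarrow> 0"
        by real_asymp
    qed (use e in simp)
    moreover have "eventually (\<lambda>n. real n \<le> (real n powr (1/3) - 1) ^ 4) sequentially"
      by real_asymp
    moreover have "eventually (\<lambda>n. 3 \<le> real n powr (1/3)) sequentially"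
      by real_asymp
    moreover have "eventually (\<lambda>n. 2 \<le> real n powr (2/3)) sequentially"
      by real_asymp
    moreover have "eventually (\<lambda>n. 4 * real j0 \<le> real n) sequentially"
      by real_asymp
    moreover have "eventually (\<lambda>n. 2 < real n / (2 * real j0)) sequentially"
      using j01 by real_asymp
    ultimately show ?thesis
    proof eventually_elim
      case (elim n)
      let ?r = "replicate_pmf n p" and ?y = "real n powr (2/3)" and ?t = "t n" and ?k = "k n"
      have n: "1 \<le> real n" using elim(7) j01 by simp
      have kk: "real n / (2 * j0) \<le> ?k" "real ?k \<le> real n / (2 * j0) + 1"
        using elim(8) unfolding k_def by linarith+
      have k2: "2 \<le> ?k" using kk(1) elim(8) by linarith
      have tt: "real ?t \<le> real n powr (1/3)" "real n powr (1/3) - 1 \<le> real ?t"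
        using elim(5) unfolding t_def by linarith+
      have t2: "2 \<le> ?t" using tt(2) elim(5) by linarith
      have powr1: "real n powr a \<le> real n" if "a \<le> 1" for a
        using powr_mono[of a 1 "real n"] that n by simp
      have tn: "?t \<le> n" using tt(1) powr1[of "1/3"] by linarith
      have yt: "?y * real ?t \<le> n"
      proof -
        have "?y * real ?t \<le> ?y * real n powr (1/3)" using tt by (intro mult_left_mono) auto
        also have "\<dots> = n" using n by (simp add: powr_add[symmetric])
        finally show ?thesis .
      qed
      have nt4: "real n \<le> real ?t ^ 4"
      proof -
        have "(real n powr (1/3) - 1) ^ 4 \<le> real ?t ^ 4"
          by (rule power_mono[OF tt(2)]) (use elim(5) in simp)
        then show ?thesis using elim(4) by linarith
      qed
      have mean_diff: "trunc_mean p n - trunc_mean p ?t \<le> 3 * C"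
      proof -
        have lt: "0 < ln (real ?t)" using t2 by simp
        have "trunc_mean p n - trunc_mean p ?t \<le> C / ln (real ?t) * ln (real n / real ?t)"
          by (rule trunc_mean_diff_le_ln) (use t2 tn scaled[of ?t] C(1) lt in auto)
        also have "\<dots> \<le> C / ln (real ?t) * (3 * ln (real ?t))"
        proof (rule mult_left_mono)
          have "ln (real n) \<le> ln (real ?t ^ 4)" using nt4 n by (intro ln_mono) auto
          also have "\<dots> = 4 * ln (real ?t)" using t2 by (simp add: ln_realpow)
          finally show "ln (real n / real ?t) \<le> 3 * ln (real ?t)"
            using n t2 by (simp add: ln_div)
        qed (use C(1) lt in auto)
        also have "\<dots> = 3 * C" using lt by simp
        finally show ?thesis .
      qed
      let ?E1 = "\<lambda>xs. \<exists>x\<in>set xs. ?k \<le> x"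
      let ?f2 = "\<lambda>x. real (min x n) - real (min x ?t)"
      let ?E2 = "\<lambda>xs. L * n \<le> sum_list (map ?f2 xs)"
      let ?E3 = "\<lambda>xs. real n \<le> \<bar>sum_list (map (\<lambda>x. real (min x j0)) xs) - n * trunc_mean p j0\<bar>"
      let ?E4 = "\<lambda>xs. ?y * (?y - 1) \<le> sum_list (map (\<lambda>x. real (min x n)) xs)"
      have "undominated_prob p n \<le> measure_pmf.prob ?r {xs. ?E1 xs \<or> ?E2 xs \<or> ?E3 xs \<or> ?E4 xs}"
        unfolding undominated_prob_def
      proof (rule prob_replicate_mono, rule ccontr)
        fix xs assume len: "length xs = n" and supp: "set xs \<subseteq> set_pmf p"
          and ex: "\<exists>j\<in>{1..n}. \<not> dominated xs j" and no: "\<not> (?E1 xs \<or> ?E2 xs \<or> ?E3 xs \<or> ?E4 xs)"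
        obtain j where j: "1 \<le> j" "j \<le> n" "\<not> dominated xs j" using ex by auto
        have "real n / (2 * j0) \<le> real n / 2"
          using j01 n by (intro divide_left_mono) auto
        then have kn: "?k \<le> n" using kk(2) elim(7) j01 by simp
        have lek: "x < ?k" if "x \<in> set xs" for x using no that by (meson not_le)
        have len': "x \<le> n" if "x \<in> set xs" for x using lek[OF that] kn by simp
        show False
        proof (cases "j \<le> j0")
          case True
          have "sum_list (map (\<lambda>x. real (x - ?k)) xs) = sum_list (map (\<lambda>_. 0) xs)"
            by (rule arg_cong[where f = sum_list], rule map_cong[OF refl]) (use lek in \<open>simp add: less_imp_le\<close>)
          then have zero: "sum_list (map (\<lambda>x. real (x - ?k)) xs) = 0" by simp
          have "real n \<le> sum_list (map (\<lambda>x. real (min x j)) xs)"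
            using length_le_sum_min[of xs j] pos supp len j by auto
          moreover have "real j * real ?k + real j \<le> real n"
          proof -
            have "real j * (real ?k + 1) \<le> real j0 * (real n / (2 * j0) + 2)"
              using True kk(2) by (intro mult_mono) auto
            also have "\<dots> = n / 2 + 2 * j0" using j01 by (simp add: field_simps)
            finally show ?thesis using elim(7) by (simp add: algebra_simps)
          qed
          ultimately have "dominated xs j"
            by (intro dominatedI_threshold[where t = ?k]) (simp add: zero)
          then show False using j by simp
        next
          case jj: False
          show False
          proof (cases "real j \<le> ?y")
            case True
            have "sum_list (map (\<lambda>x. real (x - ?t)) xs) = sum_list (map ?f2 xs)"
              by (rule arg_cong[where f = sum_list], rule map_cong[OF refl]) (use len' tn in \<open>auto simp: min_def of_nat_diff\<close>)
            then have s: "sum_list (map (\<lambda>x. real (x - ?t)) xs) \<le> L * n" using no by simp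
            have "sum_list (map (\<lambda>x. real (min x j0)) xs) \<le> sum_list (map (\<lambda>x. real (min x j)) xs)"
              by (rule sum_list_mono) (use jj in auto)
            moreover have "n * trunc_mean p j0 - n \<le> sum_list (map (\<lambda>x. real (min x j0)) xs)"
              using no by (simp add: abs_if split: if_splits)
            moreover have "real n * (L + 3) \<le> n * trunc_mean p j0" using j0 by (intro mult_left_mono) auto
            moreover have "real j * real ?t \<le> n"
              using mult_right_mono[OF True, of "real ?t"] yt by simp
            ultimately have "dominated xs j"
              by (intro dominatedI_threshold[where t = ?t]) (use s j in \<open>simp add: algebra_simps\<close>)
            then show False using j by simp
          next
            case False
            have "sum_list (map real xs) = sum_list (map (\<lambda>x. real (min x n)) xs)"
              by (rule arg_cong[where f = sum_list], rule map_cong[OF refl]) (use len' in auto)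
            then have "dominated xs j"
              by (intro dominatedI_sum[where y = ?y]) (use no False elim(6) in auto)
            then show False using j by simp
          qed
        qed
      qed
      also have "\<dots> \<le> measure_pmf.prob ?r {xs. ?E1 xs} + (measure_pmf.prob ?r {xs. ?E2 xs} +
          (measure_pmf.prob ?r {xs. ?E3 xs} + measure_pmf.prob ?r {xs. ?E4 xs}))"
        by (intro order_trans[OF prob_disj_le] add_left_mono order_refl)
      also have "measure_pmf.prob ?r {xs. ?E1 xs} \<le> e / 5"
      proof -
        have lk: "0 < ln (real n / (2 * j0))" "ln (real n / (2 * j0)) \<le> ln (real ?k)"
          using elim(8) kk(1) by (auto intro!: ln_mono)
        have "real ?k * tail p ?k \<le> C / ln (real ?k)" using scaled[of ?k ?k] k2 by simp
        also have "\<dots> \<le> C / ln (real n / (2 * j0))"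
          using lk C(1) by (intro divide_left_mono) auto
        finally have 1: "real ?k * tail p ?k \<le> C / ln (real n / (2 * j0))" .
        have "n * tail p ?k \<le> 2 * j0 * (real ?k * tail p ?k)"
        proof -
          have "real n \<le> 2 * j0 * real ?k" using kk(1) j01 by (simp add: field_simps)
          then have "n * tail p ?k \<le> 2 * j0 * real ?k * tail p ?k"
            by (rule mult_right_mono) (rule tail_nonneg)
          then show ?thesis by simp
        qed
        also have "\<dots> \<le> 2 * j0 * (C / ln (real n / (2 * j0)))"
          using 1 by (intro mult_left_mono) auto
        finally show ?thesis using prob_some_large[of n p ?k] elim(1) by simp
      qed
      also have "measure_pmf.prob ?r {xs. ?E2 xs} \<le> e / 5"
      proof -
        have "measure_pmf.prob ?r {xs. ?E2 xs} \<le> n * measure_pmf.expectation p ?f2 / (L * n)"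
          by (rule Markov_replicate_pmf) (use L n tn in auto)
        also have "measure_pmf.expectation p ?f2 = trunc_mean p n - trunc_mean p ?t"
          by (simp add: trunc_mean_def)
        also have "n * (trunc_mean p n - trunc_mean p ?t) / (L * n) \<le> n * (3 * C) / (L * n)"
          using mean_diff L by (intro divide_right_mono mult_left_mono) auto
        also have "\<dots> = 3 * C / L" using n by simp
        finally show ?thesis using L(2) by simp
      qed
      also have "measure_pmf.prob ?r {xs. ?E3 xs} \<le> e / 5"
      proof -
        have "measure_pmf.prob ?r {xs. ?E3 xs} \<le> n * measure_pmf.expectation p (\<lambda>x. (real (min x j0))\<^sup>2) / (real n)\<^sup>2"
          unfolding trunc_mean_def by (rule Chebyshev_replicate_pmf[where B = j0]) (use n in auto)
        also have "\<dots> \<le> n * (real j0)\<^sup>2 / (real n)\<^sup>2"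
        proof (intro divide_right_mono mult_left_mono)
          have "measure_pmf.expectation p (\<lambda>x. (real (min x j0))\<^sup>2) \<le> measure_pmf.expectation p (\<lambda>x. (real j0)\<^sup>2)"
          proof (rule integral_mono)
            show "integrable p (\<lambda>x. (real (min x j0))\<^sup>2)"
              by (rule integrable_bounded_pmf[where B = "(real j0)\<^sup>2"]) (auto intro!: power_mono)
          qed (auto intro!: power_mono)
          then show "measure_pmf.expectation p (\<lambda>x. (real (min x j0))\<^sup>2) \<le> (real j0)\<^sup>2" by simp
        qed auto
        also have "\<dots> = (real j0)\<^sup>2 / n" using n by (simp add: power2_eq_square)
        finally show ?thesis using elim(2) by linarith
      qed
      also have "measure_pmf.prob ?r {xs. ?E4 xs} \<le> e / 5"
      proof -
        have yp: "0 < ?y * (?y - 1)" by (rule mult_pos_pos) (use elim(6) in linarith)+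
        have "measure_pmf.prob ?r {xs. ?E4 xs} \<le> n * trunc_mean p n / (?y * (?y - 1))"
          unfolding trunc_mean_def by (rule Markov_replicate_pmf) (use yp in auto)
        also have "\<dots> \<le> n * (1 + 2 * C * ln (real n)) / (?y * (?y - 1))"
          using mean_log[of n] n yp by (intro divide_right_mono mult_left_mono) auto
        finally show ?thesis using elim(3) by linarith
      qed
      finally show ?case using e by simp
    qed
  qed
  then show ?thesis
    by (auto simp: tendsto_iff dist_real_def abs_of_nonneg undominated_prob_nonneg)
qed

section \<open>Conditioning on the absence of large degrees\<close>

lemma trunc_mean_near_log:
  assumes c: "0 < c" and sum: "(\<lambda>n. \<bar>c / real n - tail p n\<bar>) summable_on {1..}"
  obtains K where "0 \<le> K" "\<And>m. 1 \<le> m \<Longrightarrow> \<bar>trunc_mean p m - c * ln (real m)\<bar> \<le> K"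
proof -
  define S where "S = infsum (\<lambda>n. \<bar>c / real n - tail p n\<bar>) {1..}"
  have S: "\<bar>\<Sum>k=1..m. c / real k - tail p k\<bar> \<le> S" for m
  proof -
    have "\<bar>\<Sum>k=1..m. c / real k - tail p k\<bar> \<le> (\<Sum>k=1..m. \<bar>c / real k - tail p k\<bar>)"
      by (rule sum_abs)
    also have "\<dots> \<le> S"
      unfolding S_def by (rule finite_sum_le_infsum[OF sum]) auto
    finally show ?thesis .
  qed
  have "\<bar>trunc_mean p m - c * ln (real m)\<bar> \<le> S + c" if m: "1 \<le> m" for m
  proof -
    have "c * ln m \<le> c * (\<Sum>k=1..m. 1 / real k)" "c * (\<Sum>k=1..m. 1 / real k) \<le> c * (1 + ln m)"
      using sum_inverse_lower[OF m] sum_inverse_upper[OF m] c by (auto intro!: mult_left_mono)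
    then show ?thesis
      using S[of m] trunc_mean_harmonic[of p m c] by (simp add: algebra_simps abs_le_iff)
  qed
  moreover have "0 \<le> S + c" using S[of 0] c by simp
  ultimately show ?thesis using that by blast
qed

lemma prob_ex_le_sum:
  "finite A \<Longrightarrow> measure_pmf.prob p {x. \<exists>i\<in>A. P i x} \<le> (\<Sum>i\<in>A. measure_pmf.prob p {x. P i x})"
  using measure_pmf.finite_measure_subadditive_finite[of A "\<lambda>i. {x. P i x}" p]
  by (simp add: Collect_bex_eq)

text \<open>
The conditions are checked for dyadic \<open>2 ^ i \<le> j < 2 ^ Suc i\<close> with threshold \<open>t i\<close> close to \<open>n / (4 * 2 ^ i)\<close>.
Controlling the excess sums over \<open>t i\<close> one by one would cost a union bound over order \<open>log n\<close> events of
constant probability. They are instead telescoped: the increment \<open>D i\<close> from \<open>t i\<close> to \<open>t (Suc i)\<close> is bounded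
by \<open>min x (t i)\<close>, so its sum has standard deviation of order \<open>n * 2 powr (- i / 2)\<close>, and deviations of
\<open>l * n * (4/5) ^ i\<close> have summable probabilities as well as a sum of at most \<open>5 * l * n\<close>. The starting excess
over \<open>t 0\<close> vanishes because no degree exceeds \<open>b\<close>.
\<close>

lemma undominated_prob_bound:
  fixes r :: "nat pmf" and b n I :: nat and V l y :: real
  assumes supp: "\<And>x. x \<in> set_pmf r \<Longrightarrow> 1 \<le> x \<and> x \<le> b"
    and b: "b \<le> n div 4" and n: "0 < n"
    and V: "0 \<le> V" "\<And>m. measure_pmf.expectation r (\<lambda>x. (real (min x m))\<^sup>2) \<le> V * real m"
    and lam: "0 < l" and range: "4 * 2 ^ I \<le> n"
    and gap: "\<And>i. i \<le> I \<Longrightarrow> n div (4 * 2 ^ i) \<le> b \<Longrightarrow>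
      real n / 2 + real n * measure_pmf.expectation r (\<lambda>x. real (x - n div (4 * 2 ^ i)))
        + 5 * l * real n + 2 * (2::real) ^ i \<le> real n * trunc_mean r (2 ^ i) - real n"
    and y: "1 < y" "y \<le> 2 ^ Suc I"
  shows "undominated_prob r n \<le> 2 * V / l\<^sup>2 + 2 * V * 2 ^ I / real n
    + real n * measure_pmf.expectation r real / (y * (y - 1))"
proof -
  define t where "t = (\<lambda>i. n div (4 * 2 ^ i))"
  have int: "integrable r f" for f :: "nat \<Rightarrow> real"
  proof (rule integrable_measure_pmf_finite)
    show "finite (set_pmf r)" by (rule finite_subset[of _ "{..b}"]) (use supp in auto)
  qed
  have tdec: "t (Suc i) \<le> t i" for i
    unfolding t_def by (rule div_le_mono2) auto
  have tle: "real (t i) \<le> n / (4 * 2 ^ i)" for i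
    using of_nat_div_le_of_nat[of n "4 * 2 ^ i", where ?'a = real] by (simp add: t_def)
  define D where "D = (\<lambda>i x. real (x - t (Suc i)) - real (x - t i))"
  have D0: "0 \<le> D i x" "D i x \<le> real (min x (t i))" for i x
    using tdec[of i] by (auto simp: D_def min_def)
  have Db: "\<bar>D i x\<bar> \<le> real (t i)" for i x
    using D0[of i x] by auto
  \<comment> \<open>Any ratio strictly between the square root of 1/2 and 1 would do.\<close>
  let ?w = "\<lambda>i. l * n * (4/5) ^ i"
  let ?F = "\<lambda>i xs. ?w i \<le> \<bar>sum_list (map (D i) xs) - n * measure_pmf.expectation r (D i)\<bar>"
  let ?R = "\<lambda>i xs. real n \<le> \<bar>sum_list (map (\<lambda>x. real (min x (2 ^ i))) xs) - n * trunc_mean r (2 ^ i)\<bar>"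
  let ?Y = "\<lambda>xs. y * (y - 1) \<le> sum_list (map real xs)"
  let ?P = "\<lambda>Q :: nat list \<Rightarrow> bool. measure_pmf.prob (replicate_pmf n r) {xs. Q xs}"
  have "undominated_prob r n \<le> ?P (\<lambda>xs. (\<exists>i\<in>{..<I}. ?F i xs) \<or> (\<exists>i\<in>{..I}. ?R i xs) \<or> ?Y xs)"
    unfolding undominated_prob_def
  proof (rule prob_replicate_mono, rule ccontr)
    fix xs assume len: "length xs = n" and sup: "set xs \<subseteq> set_pmf r"
      and ex: "\<exists>j\<in>{1..n}. \<not> dominated xs j"
      and "\<not> ((\<exists>i\<in>{..<I}. ?F i xs) \<or> (\<exists>i\<in>{..I}. ?R i xs) \<or> ?Y xs)"
    then have F: "\<And>i. i < I \<Longrightarrow> \<not> ?F i xs" and R: "\<And>i. i \<le> I \<Longrightarrow> \<not> ?R i xs" and Y: "\<not> ?Y xs" by auto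
    obtain j where j: "1 \<le> j" "\<not> dominated xs j" using ex by auto
    have small: "sum_list (map (\<lambda>x. real (x - s)) xs) = 0" if "b \<le> s" for s
    proof -
      have "sum_list (map (\<lambda>x. real (x - s)) xs) = sum_list (map (\<lambda>_. 0) xs)"
        by (rule arg_cong[where f = sum_list], rule map_cong[OF refl]) (use supp sup that in fastforce)
      then show ?thesis by simp
    qed
    have tele: "sum_list (map (\<lambda>x. real (x - t i)) xs) \<le>
        n * measure_pmf.expectation r (\<lambda>x. real (x - t i)) + (\<Sum>k<i. ?w k)" if "i \<le> I" for i
      using that
    proof (induction i)
      case 0
      have "sum_list (map (\<lambda>x. real (x - t 0)) xs) = 0" by (rule small) (use b in \<open>simp add: t_def\<close>)
      then show ?case by (simp add: integral_nonneg_AE)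
    next
      case (Suc i)
      have "sum_list (map (\<lambda>x. real (x - t (Suc i))) xs) =
          sum_list (map (\<lambda>x. real (x - t i)) xs) + sum_list (map (D i) xs)"
        by (simp add: D_def sum_list_addf[symmetric])
      moreover have "sum_list (map (D i) xs) \<le> n * measure_pmf.expectation r (D i) + ?w i"
        using F[of i] Suc.prems by (simp add: abs_if split: if_splits)
      moreover have "measure_pmf.expectation r (\<lambda>x. real (x - t (Suc i))) =
          measure_pmf.expectation r (\<lambda>x. real (x - t i)) + measure_pmf.expectation r (D i)"
        using int by (simp add: D_def)
      ultimately show ?case using Suc by (simp add: algebra_simps)
    qed
    have wsum: "(\<Sum>k<i. ?w k) \<le> 5 * l * n" for i
    proof -
      have "(\<Sum>k<i. (4/5::real) ^ k) \<le> 5"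
        by (simp add: geometric_sum)
      then have "l * n * (\<Sum>k<i. (4/5::real) ^ k) \<le> l * n * 5" using lam by (intro mult_left_mono) auto
      then show ?thesis by (simp add: sum_distrib_left algebra_simps)
    qed
    show False
    proof (cases "y \<le> real j")
      case True
      then have "dominated xs j"
        by (intro dominatedI_sum[where y = y]) (use Y y in auto)
      then show False using j by simp
    next
      case False
      obtain i where i: "2 ^ i \<le> j" "j < 2 ^ (i + 1)"
        using ex_power_ivl1[of 2 j] j by auto
      have "real j < 2 ^ Suc I" using False y by linarith
      then have "j < 2 ^ Suc I" by (metis of_nat_less_numeral_power_cancel_iff)
      then have "(2::nat) ^ i < 2 ^ Suc I" using i by linarith
      then have "i < Suc I" by (rule power_less_imp_less_exp[rotated]) simp
      then have iI: "i \<le> I" by simp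
      have i2: "real j \<le> 2 * 2 ^ i"
      proof -
        have "j \<le> 2 * 2 ^ i" using i by simp
        then have "real j \<le> real (2 * 2 ^ i)" by (simp only: of_nat_le_iff)
        then show ?thesis by simp
      qed
      have jt: "real j * real (t i) \<le> n / 2"
      proof -
        have "real j * real (t i) \<le> (2 * 2 ^ i) * (n / (4 * 2 ^ i))"
          using i2 tle[of i] by (intro mult_mono) auto
        then show ?thesis by simp
      qed
      have "dominated xs j"
      proof (cases "t i \<le> b")
        case True
        have "sum_list (map (\<lambda>x. real (min x (2 ^ i))) xs) \<le> sum_list (map (\<lambda>x. real (min x j)) xs)"
          by (rule sum_list_mono) (use i in auto)
        moreover have "n * trunc_mean r (2 ^ i) - n \<le> sum_list (map (\<lambda>x. real (min x (2 ^ i))) xs)"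
          using R[OF iI] by (simp add: abs_if split: if_splits)
        ultimately show ?thesis
          using gap[OF iI] True tele[OF iI] wsum[of i] jt i2
          by (intro dominatedI_threshold[where t = "t i"]) (simp add: t_def)
      next
        case False
        have "(2::nat) ^ i \<le> 2 ^ I" using iI by simp
        then have "4 * 2 ^ i \<le> n" using range by linarith
        then have "real (4 * 2 ^ i) \<le> real n" by (simp only: of_nat_le_iff)
        moreover have "real n \<le> sum_list (map (\<lambda>x. real (min x j)) xs)"
          using length_le_sum_min[of xs j] supp sup len j by auto
        ultimately show ?thesis
          using jt i2 small[of "t i"] False by (intro dominatedI_threshold[where t = "t i"]) simp
      qed
      then show False using j by simp
    qed
  qed
  also have "\<dots> \<le> (\<Sum>i<I. ?P (?F i)) + ((\<Sum>i\<le>I. ?P (?R i)) + ?P ?Y)"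
    by (intro order_trans[OF prob_disj_le] add_mono prob_ex_le_sum order_refl) auto
  also have "(\<Sum>i<I. ?P (?F i)) \<le> 2 * V / l\<^sup>2"
  proof -
    have "?P (?F i) \<le> V / (4 * l\<^sup>2) * (25/32) ^ i" for i
    proof -
      have "?P (?F i) \<le> n * measure_pmf.expectation r (\<lambda>x. (D i x)\<^sup>2) / (?w i)\<^sup>2"
        by (rule Chebyshev_replicate_pmf[where B = "t i"]) (use Db n lam in auto)
      also have "measure_pmf.expectation r (\<lambda>x. (D i x)\<^sup>2) \<le> measure_pmf.expectation r (\<lambda>x. (real (min x (t i)))\<^sup>2)"
        by (rule integral_mono) (use int D0 in \<open>auto intro!: power_mono simp del: of_nat_min\<close>)
      also have "\<dots> \<le> V * t i" by (rule V(2))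
      also have "\<dots> \<le> V * (n / (4 * 2 ^ i))" using tle V(1) by (intro mult_left_mono) auto
      finally have "?P (?F i) \<le> n * (V * (n / (4 * 2 ^ i))) / (?w i)\<^sup>2"
        by (simp add: divide_right_mono mult_left_mono)
      also have "\<dots> = V / (4 * l\<^sup>2) * (1 / (2 ^ i * ((4/5) ^ i)\<^sup>2))"
        using n by (simp add: power2_eq_square)
      also have "(2::real) ^ i * ((4/5) ^ i)\<^sup>2 = (32/25) ^ i"
        by (simp add: power2_eq_square power_mult_distrib[symmetric])
      also have "1 / (32/25) ^ i = (25/32 :: real) ^ i" by (simp add: power_divide)
      finally show ?thesis .
    qed
    then have "(\<Sum>i<I. ?P (?F i)) \<le> (\<Sum>i<I. V / (4 * l\<^sup>2) * (25/32) ^ i)" by (intro sum_mono)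
    also have "\<dots> = V / (4 * l\<^sup>2) * (\<Sum>i<I. (25/32) ^ i)" by (simp add: sum_distrib_left)
    also have "\<dots> \<le> V / (4 * l\<^sup>2) * 8"
    proof (rule mult_left_mono)
      define a where "a = (25/32::real) ^ I"
      have "(\<Sum>i<I. (25/32::real) ^ i) = (a - 1) / (25/32 - 1)"
        unfolding a_def by (rule geometric_sum) simp
      also have "\<dots> = (1 - a) * (32/7)" by (simp add: field_simps)
      also have "0 \<le> a" by (simp add: a_def)
      then have "(1 - a) * (32/7) \<le> 8" by simp
      finally show "(\<Sum>i<I. (25/32::real) ^ i) \<le> 8" .
    qed (use V(1) in simp)
    finally show ?thesis by simp
  qed
  also have "(\<Sum>i\<le>I. ?P (?R i)) \<le> 2 * V * 2 ^ I / n"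
  proof -
    have "?P (?R i) \<le> V / n * 2 ^ i" for i
    proof -
      have "?P (?R i) \<le> n * measure_pmf.expectation r (\<lambda>x. (real (min x (2 ^ i)))\<^sup>2) / (real n)\<^sup>2"
        unfolding trunc_mean_def by (rule Chebyshev_replicate_pmf[where B = "2 ^ i"]) (use n in auto)
      also have "\<dots> \<le> n * (V * 2 ^ i) / (real n)\<^sup>2"
        using V(2)[of "2 ^ i"] by (intro divide_right_mono mult_left_mono) auto
      also have "\<dots> = V / n * 2 ^ i" using n by (simp add: power2_eq_square)
      finally show ?thesis .
    qed
    then have "(\<Sum>i\<le>I. ?P (?R i)) \<le> (\<Sum>i\<le>I. V / n * 2 ^ i)" by (intro sum_mono)
    also have "\<dots> = V / n * (\<Sum>i\<le>I. 2 ^ i)" by (simp add: sum_distrib_left)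
    also have "\<dots> \<le> V / n * (2 * 2 ^ I)"
    proof (rule mult_left_mono)
      show "(\<Sum>i\<le>I. (2::real) ^ i) \<le> 2 * 2 ^ I" by (induction I) auto
    qed (use V(1) in simp)
    also have "\<dots> = 2 * V * 2 ^ I / n" by simp
    finally show ?thesis .
  qed
  also have "?P ?Y \<le> n * measure_pmf.expectation r real / (y * (y - 1))"
    by (rule Markov_replicate_pmf[OF int]) (use y in auto)
  finally show ?thesis by simp
qed

context
  fixes p :: "nat pmf" and b :: nat and q :: real
  assumes q_def: "q = 1 - tail p (Suc b)" and q_pos: "0 < q"
begin

lemma prob_atMost: "measure_pmf.prob p {..b} = q"
  using prob_below[of p "Suc b"] by (simp add: q_def lessThan_Suc_atMost)

lemma atMost_meets_support: "set_pmf p \<inter> {..b} \<noteq> {}"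
  using q_pos prob_atMost measure_pmf_zero_iff[of p "{..b}"] by force

lemma expectation_cond_atMost:
  fixes f :: "nat \<Rightarrow> real"
  shows "measure_pmf.expectation (cond_pmf p {..b}) f = measure_pmf.expectation p (\<lambda>x. indicator {..b} x * f x) / q"
proof -
  have "measure_pmf.expectation (cond_pmf p {..b}) f = (\<Sum>a\<in>{..b}. f a * pmf (cond_pmf p {..b}) a)"
    by (rule integral_measure_pmf_real) (use set_cond_pmf[OF atMost_meets_support] in auto)
  also have "\<dots> = (\<Sum>a\<in>{..b}. (indicator {..b} a * f a) * pmf p a) / q"
    by (simp add: pmf_cond[OF atMost_meets_support] prob_atMost sum_divide_distrib)
  also have "(\<Sum>a\<in>{..b}. (indicator {..b} a * f a) * pmf p a) = measure_pmf.expectation p (\<lambda>x. indicator {..b} x * f x)"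
    by (rule integral_measure_pmf_real[symmetric]) (auto simp: indicator_def split: if_splits)
  finally show ?thesis .
qed

lemma integrable_indicator_atMost: "integrable p (\<lambda>x. indicator {..b} x * f x :: real)"
proof (rule integrable_bounded_pmf)
  fix x
  show "\<bar>indicator {..b} x * f x\<bar> \<le> (\<Sum>a\<le>b. \<bar>f a\<bar>)"
    using member_le_sum[of x "{..b}" "\<lambda>a. \<bar>f a\<bar>"] by (auto simp: indicator_def sum_nonneg)
qed

lemma q_le_1: "q \<le> 1" by (simp add: q_def tail_nonneg)

lemma second_moment_cond:
  assumes C: "\<And>k. real k * tail p k \<le> C" and half: "1 / 2 \<le> q"
  shows "measure_pmf.expectation (cond_pmf p {..b}) (\<lambda>x. (real (min x m))\<^sup>2) \<le> 4 * C * m"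
proof -
  have "measure_pmf.expectation p (\<lambda>x. indicator {..b} x * (real (min x m))\<^sup>2) \<le>
      measure_pmf.expectation p (\<lambda>x. (real (min x m))\<^sup>2)"
  proof (rule integral_mono[OF integrable_indicator_atMost])
    show "integrable p (\<lambda>x. (real (min x m))\<^sup>2)"
      by (rule integrable_bounded_pmf[where B = "(real m)\<^sup>2"]) (auto intro!: power_mono)
  qed (auto simp: indicator_def)
  also have "\<dots> \<le> 2 * C * m" by (rule trunc_second_moment_le[OF C])
  finally have 1: "measure_pmf.expectation p (\<lambda>x. indicator {..b} x * (real (min x m))\<^sup>2) \<le> 2 * C * m" .
  have "0 \<le> C" using C[of 0] by simp
  then have "2 * C * m \<le> 4 * C * m * q"
    using half mult_left_mono[of "1/2" q "4 * C * m"] by simp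
  then show ?thesis
    unfolding expectation_cond_atMost pos_divide_le_eq[OF q_pos] using 1 by (rule order_trans[rotated])
qed

lemma trunc_mean_cond_ge:
  "trunc_mean p m - m * tail p (Suc b) \<le> trunc_mean (cond_pmf p {..b}) m"
proof -
  have "trunc_mean p m - m * tail p (Suc b) =
      measure_pmf.expectation p (\<lambda>x. real (min x m) - real m * (indicator {Suc b..} x :: real))"
    by (simp add: trunc_mean_def tail_eq_expectation)
  also have "\<dots> \<le> measure_pmf.expectation p (\<lambda>x. indicator {..b} x * real (min x m))"
  proof (rule integral_mono[OF _ integrable_indicator_atMost])
    show "integrable p (\<lambda>x. real (min x m) - real m * (indicator {Suc b..} x :: real))"
      by (intro Bochner_Integration.integrable_diff integrable_min integrable_mult_right integrable_indicator_pmf)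
  qed (auto simp: indicator_def)
  also have "\<dots> \<le> trunc_mean (cond_pmf p {..b}) m"
  proof -
    have "0 \<le> measure_pmf.expectation p (\<lambda>x. indicator {..b} x * real (min x m))"
      by (rule integral_nonneg_AE) auto
    then show ?thesis
      using q_pos q_le_1 mult_left_le[OF q_le_1]
      unfolding trunc_mean_def expectation_cond_atMost by (simp add: pos_le_divide_eq)
  qed
  finally show ?thesis .
qed

lemma expectation_excess_cond_le:
  assumes "t \<le> b"
  shows "measure_pmf.expectation (cond_pmf p {..b}) (\<lambda>x. real (x - t)) \<le> (trunc_mean p b - trunc_mean p t) / q"
proof -
  have "measure_pmf.expectation p (\<lambda>x. indicator {..b} x * real (x - t)) \<le>
      measure_pmf.expectation p (\<lambda>x. real (min x b) - real (min x t))"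
  proof (rule integral_mono[OF integrable_indicator_atMost])
    show "integrable p (\<lambda>x. real (min x b) - real (min x t))"
      by (rule Bochner_Integration.integrable_diff) (rule integrable_min)+
    show "indicator {..b} x * real (x - t) \<le> real (min x b) - real (min x t)" for x
      using assms by (auto simp: indicator_def min_def)
  qed
  then show ?thesis
    unfolding expectation_cond_atMost using q_pos by (simp add: divide_right_mono trunc_mean_def)
qed

lemma parity_bias_cond: "parity_bias (cond_pmf p {..b}) \<le> parity_bias p / q"
proof -
  have le: "measure_pmf.prob (cond_pmf p {..b}) A \<le> measure_pmf.prob p A / q" for A
  proof -
    have "measure_pmf.prob (cond_pmf p {..b}) A = measure_pmf.expectation (cond_pmf p {..b}) (indicator A)" by simp
    also have "\<dots> \<le> measure_pmf.expectation p (indicator A) / q"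
      unfolding expectation_cond_atMost
      by (intro divide_right_mono integral_mono[OF integrable_indicator_atMost])
        (use q_pos in \<open>auto simp: indicator_def\<close>)
    finally show ?thesis by simp
  qed
  have "measure_pmf.prob p {x. even x} / q \<le> parity_bias p / q" "measure_pmf.prob p {x. odd x} / q \<le> parity_bias p / q"
    using q_pos by (auto simp: parity_bias_def intro!: divide_right_mono)
  then show ?thesis
    using le[of "{x. even x}"] le[of "{x. odd x}"]
    unfolding parity_bias_def[of "cond_pmf p {..b}"] by linarith
qed

lemma graphical_prob_ge_cond:
  "q ^ n * graphical_prob (cond_pmf p {..b}) n \<le> graphical_prob p n"
proof -
  have "q ^ n * graphical_prob (cond_pmf p {..b}) n =
      measure_pmf.prob (replicate_pmf n p) {xs. set xs \<subseteq> {..b} \<and> graphical xs}"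
    unfolding graphical_prob_def
    by (subst prob_replicate_cond_pmf[OF atMost_meets_support]) (simp add: prob_atMost)
  also have "\<dots> \<le> graphical_prob p n"
    unfolding graphical_prob_def by (rule prob_replicate_mono) simp
  finally show ?thesis .
qed

end

lemma power_one_minus_ge_exp:
  assumes "0 \<le> x" "x \<le> 1/2" "real n * x \<le> z"
  shows "exp (- (2 * z)) \<le> (1 - x) ^ n"
proof -
  have "2 * x\<^sup>2 \<le> x" using assms mult_left_mono[of x "1/2" x] by (simp add: power2_eq_square)
  then have "- 2 * x \<le> ln (1 - x)"
    using ln_one_minus_pos_lower_bound[of x] assms by linarith
  then have "exp (- 2 * x) \<le> 1 - x" using assms by (simp add: exp_le_cancel_iff[of _ "ln (1 - x)", symmetric] del: exp_le_cancel_iff)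
  then have "exp (- 2 * x) ^ n \<le> (1 - x) ^ n" by (rule power_mono) simp
  moreover have "exp (- (2 * z)) \<le> exp (- 2 * x) ^ n"
    using assms(3) by (simp add: exp_of_nat_mult[symmetric])
  ultimately show ?thesis by linarith
qed

text \<open>
Degrees are conditioned to be at most \<open>b\<close>, the integer part of \<open>a * n\<close>, an event of probability at least
\<open>exp (- 2 * C / a)\<close> for large \<open>n\<close>. Then the mean excess over \<open>t\<close> is about \<open>H b - H t\<close>, which
involves \<open>ln (8 * a)\<close> and so becomes as negative as desired relative to \<open>c * ln (2 ^ i)\<close>. The fluctuation
constant \<open>l\<close> is fixed before \<open>a\<close>, so no circularity arises.
\<close>

lemma graphical_prob_eventually_ge:
  fixes p :: "nat pmf" and c K :: real
  assumes pos: "\<And>x. x \<in> set_pmf p \<Longrightarrow> 1 \<le> x"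
    and c: "0 < c" and lim: "(\<lambda>n. real n * tail p n) \<longlonglongrightarrow> c"
    and K: "0 \<le> K" "\<And>m. 1 \<le> m \<Longrightarrow> \<bar>trunc_mean p m - c * ln (real m)\<bar> \<le> K"
    and bias: "parity_bias p < 1"
  obtains d where "0 < d" "eventually (\<lambda>n. d \<le> graphical_prob p n) sequentially"
proof -
  obtain C where C: "0 < C" "\<And>k. real k * tail p k \<le> C" using bounded_scaled_tail[OF lim] by blast
  \<comment> \<open>The conditional second moments grow with slope 4 * C; this l makes the telescoped fluctuations
    exceed their bounds with probability at most 1/8.\<close>
  define l where "l = 1 + 32 * C"
  have l: "0 < l" "64 * C \<le> l\<^sup>2" using C(1) by (auto simp: l_def power2_eq_square algebra_simps)
  \<comment> \<open>The exponent collects three errors K in approximating trunc_mean by c * ln, the fluctuations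
    5 * l, and lower order terms.\<close>
  define a where "a = exp (- (3 * K + 5 * l + 6) / c) / 8"
  have a: "0 < a" "a \<le> 1/4" "c * ln (8 * a) = - (3 * K + 5 * l + 6)"
  proof -
    have "- (3 * K + 5 * l + 6) / c \<le> 0" using K(1) l(1) c by (simp add: divide_le_0_iff)
    then have "exp (- (3 * K + 5 * l + 6) / c) \<le> 1" by (simp only: exp_le_one_iff)
    then show "a \<le> 1/4" unfolding a_def by linarith
    show "0 < a" by (simp add: a_def)
    show "c * ln (8 * a) = - (3 * K + 5 * l + 6)" using c by (simp add: a_def)
  qed
  define \<rho> where "\<rho> = parity_bias p"
  have \<rho>: "0 \<le> \<rho>" "\<rho> < 1" using bias parity_bias_nonneg by (auto simp: \<rho>_def)
  \<comment> \<open>A bound for the parity bias of the conditional law once q is at least (1 + \<rho>) / 2.\<close>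
  define s where "s = \<rho> / ((1 + \<rho>) / 2)"
  have s: "0 \<le> s" "s < 1" using \<rho> by (auto simp: s_def field_simps)
  define d where "d = exp (- (2 * (C / a))) / 8"
  have "eventually (\<lambda>n. 2 * C / (a * real n) * (c * ln (real n) + K) < 1) sequentially"
  proof (rule order_tendstoD(2))
    show "(\<lambda>n. 2 * C / (a * real n) * (c * ln (real n) + K)) \<longlonglongrightarrow> 0" using C(1) a(1) c by real_asymp
  qed simp
  moreover have "eventually (\<lambda>n. (2 + C / a) * real n powr (2/3) / real n < 3) sequentially"
  proof (rule order_tendstoD(2))
    show "(\<lambda>n. (2 + C / a) * real n powr (2/3) / real n) \<longlonglongrightarrow> 0" by real_asymp
  qed simp
  moreover have "eventually (\<lambda>n. 8 * C * real n powr (2/3) / real n < 1/16) sequentially"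
  proof (rule order_tendstoD(2))
    show "(\<lambda>n. 8 * C * real n powr (2/3) / real n) \<longlonglongrightarrow> 0" by real_asymp
  qed simp
  moreover have "eventually (\<lambda>n. real n * (2 * (c * ln (real n) + K)) /
      (real n powr (2/3) * (real n powr (2/3) - 1)) < 1/16) sequentially"
  proof (rule order_tendstoD(2))
    show "(\<lambda>n. real n * (2 * (c * ln (real n) + K)) / (real n powr (2/3) * (real n powr (2/3) - 1))) \<longlonglongrightarrow> 0"
      using c by real_asymp
  qed simp
  moreover have "eventually (\<lambda>n. 4 * real n powr (2/3) \<le> real n) sequentially" by real_asymp
  moreover have "eventually (\<lambda>n. C / (a * real n) < (1 - \<rho>) / 2) sequentially"
  proof (rule order_tendstoD(2))
    show "(\<lambda>n. C / (a * real n)) \<longlonglongrightarrow> 0" using a(1) by real_asymp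
  qed (use \<rho> in simp)
  moreover have "eventually (\<lambda>n. s ^ n < 1/4) sequentially"
    by (rule order_tendstoD(2)[OF LIMSEQ_realpow_zero[OF s]]) simp
  moreover have "eventually (\<lambda>n. 1 \<le> a * real n) sequentially" using a(1) by real_asymp
  moreover have "eventually (\<lambda>n. 2 \<le> real n powr (2/3)) sequentially" by real_asymp
  ultimately have "eventually (\<lambda>n. d \<le> graphical_prob p n) sequentially"
  proof eventually_elim
    case (elim n)
    define y where "y = real n powr (2/3)"
    define b where "b = nat \<lfloor>a * real n\<rfloor>"
    define q where "q = 1 - tail p (Suc b)"
    define r where "r = cond_pmf p {..b}"
    note ev = elim[folded y_def]
    have n: "0 < real n" using ev(5,9) by linarith
    have b1: "real b \<le> a * n" "a * n \<le> real (Suc b)" "1 \<le> b"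
      using ev(8) unfolding b_def by linarith+
    have bn: "b \<le> n div 4"
    proof -
      have "a * n \<le> n / 4" using mult_right_mono[OF a(2), of "real n"] by simp
      then have "real (4 * b) \<le> real n" using b1(1) by simp
      then show ?thesis by linarith
    qed
    have T: "tail p (Suc b) \<le> C / (a * n)"
    proof -
      have "a * n * tail p (Suc b) \<le> real (Suc b) * tail p (Suc b)"
        using b1(2) tail_nonneg by (rule mult_right_mono)
      also have "\<dots> \<le> C" by (rule C(2))
      finally show ?thesis using a(1) n by (simp add: field_simps)
    qed
    have "tail p (Suc b) \<le> (1 - \<rho>) / 2" using T ev(6) by linarith
    then have q: "(1 + \<rho>) / 2 \<le> q" by (simp add: q_def field_simps)
    then have q2: "1/2 \<le> q" "0 < q" using \<rho> by auto
    note cond = q_def q2(2)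
    have Hb: "trunc_mean p b \<le> c * ln n + K"
    proof -
      have "trunc_mean p b \<le> trunc_mean p n" by (rule trunc_mean_mono) (use bn in simp)
      also have "\<dots> \<le> c * ln n + K" using K(2)[of n] n by (simp add: abs_le_iff)
      finally show ?thesis .
    qed
    have Hb0: "0 \<le> trunc_mean p b" using trunc_mean_mono[of 0 b p] by (simp add: trunc_mean_0)
    have supp: "1 \<le> x \<and> x \<le> b" if "x \<in> set_pmf r" for x
      using that pos set_cond_pmf[OF atMost_meets_support[OF cond]] by (auto simp: r_def)
    have V: "measure_pmf.expectation r (\<lambda>x. (real (min x m))\<^sup>2) \<le> 4 * C * real m" for m
      unfolding r_def by (rule second_moment_cond[OF cond C(2) q2(1)])
    have excess: "measure_pmf.expectation r (\<lambda>x. real (x - t)) \<le> trunc_mean p b - trunc_mean p t + 1"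
      if "t \<le> b" for t
    proof -
      let ?h = "trunc_mean p b - trunc_mean p t"
      have h: "0 \<le> ?h" "?h \<le> trunc_mean p b"
        using trunc_mean_mono[OF that, of p] trunc_mean_mono[of 0 t p] by (auto simp: trunc_mean_0)
      have "1 / q \<le> 1 + 2 * (1 - q)"
      proof -
        have "0 \<le> (1 - q) * (2 * q - 1)" using q2 q_le_1[OF cond] by simp
        then have "1 \<le> (1 + 2 * (1 - q)) * q" by (simp add: algebra_simps)
        then show ?thesis using q2 by (simp add: pos_divide_le_eq)
      qed
      then have "?h * (1 / q) \<le> ?h * (1 + 2 * tail p (Suc b))"
        using h by (intro mult_left_mono) (auto simp: q_def)
      also have "\<dots> = ?h + 2 * tail p (Suc b) * ?h" by (simp add: algebra_simps)
      also have "2 * tail p (Suc b) * ?h \<le> 2 * (C / (a * n)) * (c * ln n + K)"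
        using T h Hb tail_nonneg[of p "Suc b"] by (intro mult_mono) auto
      also have "\<dots> \<le> 1" using ev(1) by simp
      finally show ?thesis
        using expectation_excess_cond_le[OF cond that] by (simp add: r_def)
    qed
    have y: "1 < y" using ev(9) by simp
    obtain I where I: "2 ^ I \<le> nat \<lfloor>y\<rfloor>" "nat \<lfloor>y\<rfloor> < 2 ^ (I + 1)"
      using ex_power_ivl1[of 2 "nat \<lfloor>y\<rfloor>"] ev(9) by (auto simp: le_nat_iff le_floor_iff)
    have Iy: "2 ^ I \<le> y" "y \<le> 2 ^ Suc I"
    proof -
      have fl: "real (nat \<lfloor>y\<rfloor>) \<le> y" "y < real (nat \<lfloor>y\<rfloor>) + 1" using y by linarith+
      have "real (2 ^ I) \<le> real (nat \<lfloor>y\<rfloor>)" using I(1) by (simp only: of_nat_le_iff)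
      then have "real (2 ^ I) \<le> y" using fl by linarith
      then show "2 ^ I \<le> y" by simp
      have "real (nat \<lfloor>y\<rfloor> + 1) \<le> real (2 ^ (I + 1))" using I(2) by (simp only: of_nat_le_iff)
      then have "y \<le> real (2 ^ (I + 1))" using fl by linarith
      then show "y \<le> 2 ^ Suc I" by simp
    qed
    have fourI: "4 * 2 ^ I \<le> n"
    proof -
      have "real (4 * 2 ^ I) \<le> real n" using Iy(1) ev(5) by simp
      then show ?thesis by (simp only: of_nat_le_iff)
    qed
    have "undominated_prob r n \<le> 2 * (4 * C) / l\<^sup>2 + 2 * (4 * C) * 2 ^ I / real n
        + real n * measure_pmf.expectation r real / (y * (y - 1))"
    proof (rule undominated_prob_bound[OF supp bn _ _ V l(1) fourI _ y Iy(2)])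
      fix i assume i: "i \<le> I" and tb: "n div (4 * 2 ^ i) \<le> b"
      define m :: nat where "m = 2 ^ i"
      define t where "t = n div (4 * m)"
      have m1: "1 \<le> m" by (simp add: m_def)
      have mI: "m \<le> 2 ^ I" using i by (simp add: m_def)
      then have my: "real m \<le> y" using Iy(1) by (metis of_nat_le_iff of_nat_numeral of_nat_power order_trans)
      have mn: "4 * m \<le> n" using mI fourI by linarith
      then have t1: "1 \<le> t" using m1 by (simp add: t_def Suc_le_eq div_greater_zero_iff)
      have "n \<le> 8 * m * t"
      proof -
        have "n < 4 * m * t + 4 * m" using m1 dividend_less_div_times[of "4 * m" n] by (simp add: t_def mult.commute)
        also have "\<dots> \<le> 4 * m * t + 4 * m * t" using t1 by simp
        finally show ?thesis by simp
      qed
      then have "real n \<le> real (8 * m * t)" by (simp only: of_nat_le_iff)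
      then have nt: "real n \<le> 8 * real m * real t" by simp
      have "real b / real t \<le> 8 * a * m"
      proof -
        have "real b \<le> a * (8 * real m * real t)" using b1(1) mult_left_mono[OF nt, of a] a(1) by linarith
        then show ?thesis using t1 by (simp add: field_simps)
      qed
      then have "ln (real b / real t) \<le> ln (8 * a * m)" using b1 t1 by (intro ln_mono) auto
      then have lnb: "ln (real b) - ln (real t) \<le> ln (8 * a) + ln (real m)"
        using b1 t1 m1 a(1) by (simp add: ln_div ln_mult)
      have "trunc_mean p b - trunc_mean p t \<le> (c * ln b + K) - (c * ln t - K)"
        using K(2)[of b] K(2)[of t] b1 t1 by (simp add: abs_le_iff)
      also have "\<dots> \<le> c * (ln (8 * a) + ln (real m)) + 2 * K"
        using mult_left_mono[OF lnb, of c] c by (simp add: algebra_simps)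
      finally have "trunc_mean p b - trunc_mean p t \<le> c * ln m - K - 5 * l - 6"
        using a(3) by (simp add: algebra_simps)
      then have ex: "measure_pmf.expectation r (\<lambda>x. real (x - t)) \<le> c * ln m - K - 5 * l - 5"
        using excess[of t] tb by (simp add: t_def m_def)
      have "c * ln m - K - m * (C / (a * n)) \<le> trunc_mean r m"
      proof -
        have "m * tail p (Suc b) \<le> m * (C / (a * n))" using T by (intro mult_left_mono) auto
        then show ?thesis
          using trunc_mean_cond_ge[OF cond, of m] K(2)[OF m1] by (simp add: r_def abs_le_iff)
      qed
      then have "real n * (c * ln m - K - m * (C / (a * n))) \<le> real n * trunc_mean r m"
        by (rule mult_left_mono) simp
      then have lower: "real n * (c * ln m - K) - m * (C / a) \<le> real n * trunc_mean r m"
      proof -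
        have "real n * (c * ln m - K - m * (C / (a * n))) = real n * (c * ln m - K) - m * (real n * (C / (a * n)))"
          by (simp only: right_diff_distrib mult.left_commute)
        moreover have "real n * (C / (a * n)) = C / a" using n by simp
        ultimately show ?thesis
          using \<open>real n * (c * ln m - K - m * (C / (a * n))) \<le> real n * trunc_mean r m\<close> by simp
      qed
      have upper: "real n * measure_pmf.expectation r (\<lambda>x. real (x - t)) \<le> real n * (c * ln m - K - 5 * l - 5)"
        using ex by (rule mult_left_mono) simp
      have "(2 + C / a) * m \<le> (2 + C / a) * y" using my C(1) a(1) by (intro mult_left_mono) auto
      also have "\<dots> \<le> 3 * n" using ev(2) n by (simp add: field_simps)
      finally have "2 * real m + m * (C / a) \<le> 3 * n" by (simp add: algebra_simps)
      then have "real n / 2 + real n * measure_pmf.expectation r (\<lambda>x. real (x - t)) + 5 * l * real n + 2 * real m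
          \<le> real n * trunc_mean r m - real n"
        using lower upper by (simp add: algebra_simps)
      then show "real n / 2 + real n * measure_pmf.expectation r (\<lambda>x. real (x - n div (4 * 2 ^ i)))
          + 5 * l * real n + 2 * 2 ^ i \<le> real n * trunc_mean r (2 ^ i) - real n"
        by (simp add: t_def m_def)
    qed (use n C(1) in auto)
    also have "2 * (4 * C) / l\<^sup>2 \<le> 1/8"
      using l C(1) by (simp add: field_simps)
    also have "2 * (4 * C) * 2 ^ I / real n \<le> 8 * C * y / real n"
      using Iy(1) C(1) n by (intro divide_right_mono) auto
    also have "\<dots> \<le> 1/16" using ev(3) by simp
    also have "real n * measure_pmf.expectation r real / (y * (y - 1)) \<le>
        real n * (2 * (c * ln n + K)) / (y * (y - 1))"
    proof (intro divide_right_mono mult_left_mono)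
      have "measure_pmf.expectation r (\<lambda>x. real (x - 0)) \<le> trunc_mean p b / q"
        using expectation_excess_cond_le[OF cond, of 0] by (simp add: r_def trunc_mean_0)
      also have "\<dots> \<le> trunc_mean p b / (1/2)" using q2 Hb0 by (intro divide_left_mono) auto
      finally show "measure_pmf.expectation r real \<le> 2 * (c * ln n + K)" using Hb by simp
    qed (use y in auto)
    also have "\<dots> \<le> 1/16" using ev(4) by simp
    finally have bad: "undominated_prob r n \<le> 1/4" by simp
    have "parity_bias r \<le> \<rho> / q" unfolding r_def \<rho>_def by (rule parity_bias_cond[OF cond])
    also have "\<dots> \<le> s" unfolding s_def using q \<rho> q2 by (intro divide_left_mono) auto
    finally have "parity_bias r ^ n \<le> s ^ n" by (rule power_mono) (rule parity_bias_nonneg)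
    then have "parity_bias r ^ n \<le> 1/4" using ev(7) by simp
    then have "1/8 \<le> graphical_prob r n"
      using graphical_prob_ge[of n r] prob_even_bounds[of n r] bad unfolding abs_le_iff by linarith
    moreover have "exp (- (2 * (C / a))) \<le> q ^ n"
    proof -
      have "real n * tail p (Suc b) \<le> n * (C / (a * n))" using T by (intro mult_left_mono) auto
      also have "\<dots> = C / a" using n by simp
      finally show ?thesis
        unfolding q_def by (intro power_one_minus_ge_exp) (use q2 tail_nonneg in \<open>auto simp: q_def\<close>)
    qed
    ultimately have "exp (- (2 * (C / a))) * (1/8) \<le> q ^ n * graphical_prob r n"
      using q2 by (intro mult_mono) auto
    also have "\<dots> \<le> graphical_prob p n" unfolding r_def by (rule graphical_prob_ge_cond[OF cond])
    finally show ?case by (simp add: d_def)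
  qed
  moreover have "0 < d" by (simp add: d_def)
  ultimately show ?thesis using that by blast
qed

section \<open>The limit points\<close>

lemma limit_points_of_convergent:
  assumes "f \<longlonglongrightarrow> l"
  shows "limit_points f = {l}"
proof -
  have "l \<in> limit_points f"
    unfolding limit_points_def
    by (intro CollectI exI[of _ id]) (simp add: assms strict_mono_def)
  moreover have "l' = l" if "l' \<in> limit_points f" for l'
  proof -
    obtain r where r: "strict_mono r" "(f \<circ> r) \<longlonglongrightarrow> l'"
      using \<open>l' \<in> limit_points f\<close> unfolding limit_points_def by blast
    show ?thesis by (rule LIMSEQ_unique[OF r(2) LIMSEQ_subseq_LIMSEQ[OF assms r(1)]])
  qed
  ultimately show ?thesis by blast
qed

lemma limit_points_subset:
  assumes lower: "eventually (\<lambda>n. a \<le> f n) sequentially"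
    and upper: "eventually (\<lambda>n. f n \<le> g n) sequentially" and lim: "g \<longlonglongrightarrow> b"
  shows "limit_points f \<subseteq> {a..b}"
proof
  fix l assume "l \<in> limit_points f"
  then obtain r where r: "strict_mono r" "(f \<circ> r) \<longlonglongrightarrow> l" unfolding limit_points_def by blast
  note sub = filterlim_subseq[OF r(1)]
  have "a \<le> l"
    by (rule tendsto_lowerbound[OF r(2)])
      (use eventually_compose_filterlim[OF lower sub] in simp_all)
  moreover have "l \<le> b"
    by (rule tendsto_le[OF _ LIMSEQ_subseq_LIMSEQ[OF lim r(1)] r(2)])
      (use eventually_compose_filterlim[OF upper sub] in simp_all)
  ultimately show "l \<in> {a..b}" by simp
qed

lemma bounded_of_SUP_ereal:
  fixes f :: "nat \<Rightarrow> real"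
  assumes "(SUP n\<in>{1..}. ereal (f n)) < \<infinity>"
  obtains C where "0 \<le> C" "\<And>n. 1 \<le> n \<Longrightarrow> f n \<le> C"
proof -
  have up: "ereal (f n) \<le> (SUP n\<in>{1..}. ereal (f n))" if "1 \<le> n" for n
    using that by (intro SUP_upper) auto
  have "(SUP n\<in>{1..}. ereal (f n)) \<noteq> -\<infinity>"
  proof
    assume "(SUP n\<in>{1..}. ereal (f n)) = -\<infinity>"
    then show False using up[of 1] by simp
  qed
  then obtain c where c: "(SUP n\<in>{1..}. ereal (f n)) = ereal c"
    using assms by (cases "SUP n\<in>{1..}. ereal (f n)") auto
  have "f n \<le> max 0 c" if "1 \<le> n" for n using up[OF that] unfolding c by simp
  then show ?thesis using that[of "max 0 c"] by simp
qed

theorem mainTheorem1: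
  fixes M :: "'a measure" and D :: "'a \<Rightarrow> nat"
    and N :: "'b measure" and X :: "nat \<Rightarrow> 'b \<Rightarrow> nat"
    and \<Lambda> :: "real set"
  assumes "prob_space M"
    and "D \<in> measurable M (count_space UNIV)"
    and "\<forall>\<omega>\<in>space M. 0 < D \<omega>"
    and "0 < \<P>(\<omega> in M. even (D \<omega>))" and "\<P>(\<omega> in M. even (D \<omega>)) < 1"
    and "prob_space N"
    and "prob_space.indep_vars N (\<lambda>_. count_space UNIV) X {1..}"
    and "\<forall>i\<ge>1. distr N (count_space UNIV) (X i) = distr M (count_space UNIV) D"
    and "\<Lambda> = limit_points (prob_graphical N X)"
  shows
    "(filterlim (\<lambda>n. real n * \<P>(\<omega> in M. n \<le> D \<omega>)) at_top sequentially
        \<longrightarrow> \<Lambda> = {0})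
   \<and> (\<forall>c::real. 0 < c
        \<and> (\<lambda>n. real n * \<P>(\<omega> in M. n \<le> D \<omega>)) \<longlonglongrightarrow> c
        \<and> filterlim (\<lambda>m. \<Sum>n=1..m. c / real n - \<P>(\<omega> in M. n \<le> D \<omega>)) at_top sequentially
        \<longrightarrow> \<Lambda> = {0})
   \<and> (\<forall>c::real. 0 < c
        \<and> (\<lambda>n. real n * \<P>(\<omega> in M. n \<le> D \<omega>)) \<longlonglongrightarrow> c
        \<and> 0 < liminf (\<lambda>n. ereal ((real n)^2 * \<P>(\<omega> in M. D \<omega> = n)))
        \<and> limsup (\<lambda>n. ereal ((real n)^2 * \<P>(\<omega> in M. D \<omega> = n))) < \<infinity>
        \<and> (\<lambda>n. \<bar>c / real n - \<P>(\<omega> in M. n \<le> D \<omega>)\<bar>) summable_on {1..}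
        \<longrightarrow> \<Lambda> \<subseteq> {0<..<1/2})
   \<and> (integrable M (\<lambda>\<omega>. real (D \<omega>))
        \<or> (SUP n\<in>{1..}. ereal (real n * ln (real n) * \<P>(\<omega> in M. n \<le> D \<omega>))) < \<infinity>
        \<longrightarrow> \<Lambda> = {1/2})"
proof -
  interpret M: prob_space M by fact
  note D = assms(2)
  obtain p where p: "measure_pmf p = distr M (count_space UNIV) D"
    using pmf_of_countable_distr[OF assms(1,2)] .
  have law: "measure_pmf.prob p {x. Q x} = \<P>(\<omega> in M. Q (D \<omega>))" for Q
    unfolding p by (subst measure_distr[OF D]) (auto intro!: arg_cong[of _ _ "measure M"])
  have T: "\<P>(\<omega> in M. n \<le> D \<omega>) = tail p n" for n
    using law[of "\<lambda>x. n \<le> x"] by (simp add: tail_def atLeast_def)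
  have pos: "1 \<le> x" if "x \<in> set_pmf p" for x
  proof (rule ccontr)
    assume "\<not> 1 \<le> x"
    then have "x = 0" by simp
    then have "0 < pmf p 0" using that by (simp add: pmf_positive)
    moreover have "pmf p 0 = \<P>(\<omega> in M. D \<omega> = 0)"
      using law[of "\<lambda>x. x = 0"] by (simp add: measure_pmf_single)
    moreover have "{\<omega> \<in> space M. D \<omega> = 0} = {}" using assms(3) by auto
    ultimately show False by simp
  qed
  have bias: "parity_bias p < 1"
    using assms(4,5) law[of even] prob_odd[of p] by (simp add: parity_bias_def)
  have G: "prob_graphical N X = graphical_prob p"
  proof
    fix n
    have "\<And>i. 1 \<le> i \<Longrightarrow> distr N (count_space UNIV) (X i) = measure_pmf p" using assms(8) p by simp
    then show "prob_graphical N X n = graphical_prob p n"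
      unfolding prob_graphical_def graphical_prob_def by (rule iid_list_replicate_pmf[OF assms(6,7)])
  qed
  have int: "integrable M (\<lambda>\<omega>. real (D \<omega>)) \<longleftrightarrow> integrable (measure_pmf p) real"
    unfolding p by (subst integrable_distr_eq[OF D]) auto
  have a: "filterlim (\<lambda>n. real n * tail p n) at_top sequentially \<Longrightarrow> \<Lambda> = {0}"
    unfolding assms(9) G by (intro limit_points_of_convergent graphical_prob_tendsto_0_heavy)
  have b: "\<Lambda> = {0}" if "0 < c" "(\<lambda>n. real n * tail p n) \<longlonglongrightarrow> c"
    "filterlim (\<lambda>m. \<Sum>n=1..m. c / real n - tail p n) at_top sequentially" for c
    unfolding assms(9) G by (rule limit_points_of_convergent, rule graphical_prob_tendsto_0_critical[OF that])
  have c: "\<Lambda> \<subseteq> {0<..<1/2}" if c: "0 < c" "(\<lambda>n. real n * tail p n) \<longlonglongrightarrow> c"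
    and sum: "(\<lambda>n. \<bar>c / real n - tail p n\<bar>) summable_on {1..}" for c
  proof -
    obtain K where K: "0 \<le> K" "\<And>m. 1 \<le> m \<Longrightarrow> \<bar>trunc_mean p m - c * ln (real m)\<bar> \<le> K"
      using trunc_mean_near_log[OF c(1) sum] by blast
    obtain d where d: "0 < d" "eventually (\<lambda>n. d \<le> graphical_prob p n) sequentially"
      using graphical_prob_eventually_ge[OF pos c K bias] by blast
    have "(\<lambda>n. parity_bias p ^ n) \<longlonglongrightarrow> 0"
      using bias parity_bias_nonneg by (intro LIMSEQ_realpow_zero) auto
    then have "(\<lambda>n. (exp (- (real n * tail p n)) + parity_bias p ^ n) / 2) \<longlonglongrightarrow> (exp (- c) + 0) / 2"
      by (intro tendsto_divide tendsto_add tendsto_exp tendsto_minus c(2) tendsto_const) auto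
    from limit_points_subset[OF d(2) always_eventually this]
    have "limit_points (graphical_prob p) \<subseteq> {d..(exp (- c) + 0) / 2}"
      using graphical_prob_le_even[of p] by blast
    also have "\<dots> \<subseteq> {0<..<1/2}"
    proof -
      have "(exp (- c) + 0) / 2 < 1/2" using c(1) by simp
      then show ?thesis using d(1) by (auto simp only: greaterThanLessThan_iff atLeastAtMost_iff)
    qed
    finally show ?thesis unfolding assms(9) G .
  qed
  have d: "\<Lambda> = {1/2}" if "undominated_prob p \<longlonglongrightarrow> 0"
    unfolding assms(9) G by (intro limit_points_of_convergent graphical_prob_tendsto_half bias that)
  have d1: "\<Lambda> = {1/2}" if "integrable (measure_pmf p) real"
    by (rule d[OF undominated_prob_tendsto_0_integrable[OF that pos]])
  have d2: "\<Lambda> = {1/2}" if sup: "(SUP n\<in>{1..}. ereal (real n * ln (real n) * tail p n)) < \<infinity>"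
  proof (cases "integrable (measure_pmf p) real")
    case False
    obtain C where C: "0 \<le> C" "\<And>n. 1 \<le> n \<Longrightarrow> real n * ln (real n) * tail p n \<le> C"
      using bounded_of_SUP_ereal[OF sup] by blast
    show ?thesis
      by (rule d, rule undominated_prob_tendsto_0_log[OF pos C(1) _ False]) (use C(2) in auto)
  qed (rule d1)
  show ?thesis
    unfolding T int
  proof (intro conjI allI impI)
    assume "integrable (measure_pmf p) real \<or>
      (SUP n\<in>{1..}. ereal (real n * ln (real n) * tail p n)) < \<infinity>"
    then show "\<Lambda> = {1/2}" by (rule disjE) (fact d1 d2)+
  qed (use a in blast, (elim conjE, rule b; assumption), (elim conjE, rule c; assumption))
qed

end
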